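(* Let $\mathbf i$ be an infinite reduced word in the alphabet $\mathbb Z/n\mathbb Z$. The following are equivalent: (1) $[\mathbf i]=[c^\infty]$ for some Coxeter element $c$ of $\tilde W$; (2) $[\mathbf i]$ is fully commutative; (3) $[\mathbf i]$ is a minimal element of the limit weak order $(\tilde{\mathcal W},\le)$.
   Context: $\tilde W$ is the affine symmetric group with simple generators $s_i$ and simple roots $\alpha_i$, $i\in\mathbb Z/n\mathbb Z$. For $w$ with reduced word $j_1\cdots j_k$, $\mathrm{Inv}(w)=\{\alpha_{j_1},s_{j_1}\alpha_{j_2},\dots,s_{j_1}\cdots s_{j_{k-1}}\alpha_{j_k}\}$. An infinite word is reduced if each prefix of length $k$ is a reduced word of an element of length $k$. $\mathrm{Inv}(\mathbf i)$ is the union of the inversion sets of its prefixes. $[\mathbf i]$ denotes the class of infinite reduced words with the same inversion set as $\mathbf i$ (braid-equivalence). $\tilde{\mathcal W}$ is the set of such classes, and $[\mathbf i]\le[\mathbf j]$ iff $\mathrm{Inv}(\mathbf i)\subseteq\mathrm{Inv}(\mathbf j)$. A Coxeter element $c\in\tilde W$ is an element having a reduced word using each $i\in\mathbb Z/n\mathbb Z$ exactly once. $c^\infty$ is the infinite word obtained by repeating such a reduced word; it is reduced. $[\mathbf i]$ is fully commutative if no three-term braid move $i(i+1)i\to(i+1)i(i+1)$ (or its reverse) can be applied to any word in $[\mathbf i]$. *)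

theory Defs
  imports Main
begin

text \<open>Throughout, \<open>n \<ge> 2\<close> and an element of \<open>\<int>/n\<int>\<close> is represented by its
  representative \<open>i < n\<close>.\<close>

definition affine_symmetric_group :: "nat \<Rightarrow> (int \<Rightarrow> int) set" where
  "affine_symmetric_group n =
     {w. bij w \<and> (\<forall>k. w (k + int n) = w k + int n) \<and>
         (\<Sum>k = 1..int n. w k) = (\<Sum>k = 1..int n. k)}"

definition simple_gen :: "nat \<Rightarrow> nat \<Rightarrow> int \<Rightarrow> int" where
  "simple_gen n i k =
     (if k mod int n = int i mod int n then k + 1
      else if k mod int n = (int i + 1) mod int n then k - 1
      else k)"

definition is_word :: "nat \<Rightarrow> nat list \<Rightarrow> bool" where
  "is_word n u \<longleftrightarrow> set u \<subseteq> {..<n}"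

definition word_prod :: "nat \<Rightarrow> nat list \<Rightarrow> int \<Rightarrow> int" where
  "word_prod n u = foldr (\<lambda>i f. simple_gen n i \<circ> f) u id"

definition cox_length :: "nat \<Rightarrow> (int \<Rightarrow> int) \<Rightarrow> nat" where
  "cox_length n w = (LEAST k. \<exists>u. is_word n u \<and> word_prod n u = w \<and> length u = k)"

definition reduced_word :: "nat \<Rightarrow> (int \<Rightarrow> int) \<Rightarrow> nat list \<Rightarrow> bool" where
  "reduced_word n w u \<longleftrightarrow> is_word n u \<and> word_prod n u = w \<and> length u = cox_length n w"

text \<open>A vector \<open>v\<close> stands for the element \<open>\<Sum>i<n. v i * \<alpha>\<^sub>i\<close> of the root lattice of type
  \<open>A\<close> affine.\<close>

definition simple_root :: "nat \<Rightarrow> nat \<Rightarrow> int" where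
  "simple_root i = (\<lambda>j. if j = i then 1 else 0)"

text \<open>The reflection \<open>v - \<langle>v, \<alpha>\<^sub>i\<^sup>\<or>\<rangle> \<alpha>\<^sub>i\<close> only changes the \<open>i\<close>-th coordinate, and
  \<open>\<langle>v, \<alpha>\<^sub>i\<^sup>\<or>\<rangle> = 2 v\<^sub>i - v\<^sub>i\<^sub>+\<^sub>1 - v\<^sub>i\<^sub>-\<^sub>1\<close> (for \<open>n = 2\<close> the two neighbours coincide, which gives the
  Cartan entries \<open>-2\<close>).\<close>

definition simple_refl :: "nat \<Rightarrow> nat \<Rightarrow> (nat \<Rightarrow> int) \<Rightarrow> (nat \<Rightarrow> int)" where
  "simple_refl n i v = v(i := v ((i + 1) mod n) + v ((i + n - 1) mod n) - v i)"

text \<open>The action of \<open>s\<^sub>j\<^sub>1 \<dots> s\<^sub>j\<^sub>k\<close> on the root lattice.\<close>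

definition word_act :: "nat \<Rightarrow> nat list \<Rightarrow> (nat \<Rightarrow> int) \<Rightarrow> (nat \<Rightarrow> int)" where
  "word_act n u = foldr (\<lambda>i f. simple_refl n i \<circ> f) u id"

definition inversions :: "nat \<Rightarrow> nat list \<Rightarrow> (nat \<Rightarrow> int) set" where
  "inversions n u = {word_act n (take m u) (simple_root (u ! m)) | m. m < length u}"

text \<open>The root \<open>\<alpha>\<^sub>a + \<dots> + \<alpha>\<^sub>b\<^sub>-\<^sub>1\<close> for integers \<open>a < b\<close> (indices mod \<open>n\<close>), and its negative
  for \<open>b < a\<close>. In these terms the action on roots is \<open>w \<alpha>\<^sub>a\<^sub>b = \<alpha>\<^bsub>w(a) w(b)\<^esub>\<close>; in particular it
  depends only on the affine permutation and not on the word.\<close>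

definition affine_root :: "nat \<Rightarrow> int \<Rightarrow> int \<Rightarrow> nat \<Rightarrow> int" where
  "affine_root n a b =
     (\<lambda>j. if j < n then (b - 1 - int j) div int n - (a - 1 - int j) div int n else 0)"

lemma simple_root_eq_root:
  assumes "n \<ge> 2" "i < n"
  shows "simple_root i = affine_root n (int i) (int i + 1)"
proof
  fix j
  show "simple_root i j = affine_root n (int i) (int i + 1) j"
  proof (cases "j < n")
    case False
    then show ?thesis using assms by (auto simp: simple_root_def affine_root_def)
  next
    case True
    consider "j < i" | "j = i" | "j > i" by linarith
    then show ?thesis
    proof cases
      case 1
      then have "(int i - int j) div int n = 0" "(int i - 1 - int j) div int n = 0"
        using assms True by (auto intro!: div_pos_pos_trivial)
      with 1 True show ?thesis by (simp add: simple_root_def affine_root_def)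
    next
      case 2
      have "(- 1) div int n = - 1" using assms by (intro div_eq_minus1) auto
      with 2 True show ?thesis by (simp add: simple_root_def affine_root_def)
    next
      case 3
      have "(int i - int j) div int n = - 1" "(int i - 1 - int j) div int n = - 1"
        using assms True 3 by (auto intro!: int_div_neg_eq[where r = "int i - int j + int n"]
            int_div_neg_eq[where r = "int i - 1 - int j + int n"] simp: div_eq_minus1
            int_div_pos_eq[where q = "-1" and r = "int i - int j + int n"]
            int_div_pos_eq[where q = "-1" and r = "int i - 1 - int j + int n"])
      with 3 True show ?thesis by (simp add: simple_root_def affine_root_def)
    qed
  qed
qed

lemma simple_gen_div_same:
  assumes "n \<ge> 2" "i < n"
  shows "(simple_gen n i a - 1 - int i) div int n =
         (a - 2 - int i) div int n + (a - int i) div int n - (a - 1 - int i) div int n"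
proof -
  define t where "t = a - int i"
  define q where "q = t div int n"
  define r where "r = t mod int n"
  have n: "int n \<ge> 2" using assms by simp
  have t: "t = int n * q + r" by (simp add: q_def r_def)
  have r: "0 \<le> r" "r < int n" using n by (auto simp: r_def)
  have a: "a = int n * q + r + int i" using t by (simp add: t_def)
  have m0: "a mod int n = int i mod int n \<longleftrightarrow> r = 0"
    by (simp add: r_def t_def mod_eq_dvd_iff dvd_eq_mod_eq_0)
  have m1: "a mod int n = (int i + 1) mod int n \<longleftrightarrow> r = 1"
  proof -
    have "a mod int n = (int i + 1) mod int n \<longleftrightarrow> t mod int n = 1 mod int n"
      by (simp add: t_def mod_eq_dvd_iff algebra_simps)
    then show ?thesis using n by (simp add: r_def)
  qed
  have q1: "(int n * q + c) div int n = q" if "0 \<le> c" "c < int n" for c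
    using that by (intro int_div_pos_eq) auto
  have q2: "(int n * q + c) div int n = q - 1" if "- int n \<le> c" "c < 0" for c
    using that by (intro int_div_pos_eq[where r = "c + int n"]) (auto simp: algebra_simps)
  consider "r = 0" | "r = 1" | "r \<ge> 2" using r by linarith
  then show ?thesis
  proof cases
    case 1
    then have "simple_gen n i a = a + 1" using m0 by (simp add: simple_gen_def)
    then show ?thesis using 1 a q1[of 0] q2[of "-1"] q2[of "-2"] n by (simp add: algebra_simps)
  next
    case 2
    then have "simple_gen n i a = a - 1" using m0 m1 by (simp add: simple_gen_def)
    then show ?thesis using 2 a q1[of 0] q1[of 1] q2[of "-1"] n by (simp add: algebra_simps)
  next
    case 3
    then have "simple_gen n i a = a" using m0 m1 by (simp add: simple_gen_def)
    then show ?thesis using 3 a q1[of r] q1[of "r - 1"] q1[of "r - 2"] r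
      by (simp add: algebra_simps)
  qed
qed

lemma simple_gen_div_other:
  assumes "n \<ge> 2" "i < n" "j < n" "j \<noteq> i"
  shows "(simple_gen n i a - 1 - int j) div int n = (a - 1 - int j) div int n"
proof -
  define t where "t = a - 1 - int j"
  have n: "int n \<ge> 2" using assms by simp
  have nd: "\<not> int n dvd int i - int j"
  proof
    assume "int n dvd int i - int j"
    then have "int i mod int n = int j mod int n" by (simp add: mod_eq_dvd_iff)
    then show False using assms by simp
  qed
  define q where "q = t div int n"
  define r where "r = t mod int n"
  have t: "t = int n * q + r" by (simp add: q_def r_def)
  have r: "0 \<le> r" "r < int n" using n by (auto simp: r_def)
  have q1: "(int n * q + c) div int n = q" if "0 \<le> c" "c < int n" for c
    using that by (intro int_div_pos_eq) auto
  show ?thesis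
  proof (cases "a mod int n = int i mod int n")
    case True
    have "r \<noteq> int n - 1"
    proof
      assume "r = int n - 1"
      then have "a - int j = int n * (q + 1)" using t by (simp add: t_def algebra_simps)
      then have "int n dvd a - int j" by simp
      moreover have "int n dvd a - int i" using True by (simp add: mod_eq_dvd_iff)
      ultimately have "int n dvd (a - int j) - (a - int i)" by (rule dvd_diff)
      then show False using nd by simp
    qed
    moreover have "simple_gen n i a - 1 - int j = int n * q + (r + 1)"
      using True t by (simp add: simple_gen_def t_def)
    moreover have "a - 1 - int j = int n * q + r" using t by (simp add: t_def)
    ultimately show ?thesis using q1[of r] q1[of "r + 1"] r by (smt (verit))
  next
    case F: False
    show ?thesis
    proof (cases "a mod int n = (int i + 1) mod int n")
      case True
      have "r \<noteq> 0"
      proof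
        assume "r = 0"
        then have "int n dvd a - 1 - int j" using t by (simp add: t_def)
        moreover have "int n dvd a - (int i + 1)" using True by (simp only: mod_eq_dvd_iff)
        ultimately have "int n dvd (a - 1 - int j) - (a - (int i + 1))" by (rule dvd_diff)
        then show False using nd by simp
      qed
      moreover have "simple_gen n i a - 1 - int j = int n * q + (r - 1)"
        using True F t by (simp add: simple_gen_def t_def)
      moreover have "a - 1 - int j = int n * q + r" using t by (simp add: t_def)
      ultimately show ?thesis using q1[of r] q1[of "r - 1"] r by (smt (verit))
    next
      case False
      then show ?thesis using F by (simp add: simple_gen_def)
    qed
  qed
qed

lemma simple_refl_root:
  assumes "n \<ge> 2" "i < n"
  shows "simple_refl n i (affine_root n a b) = affine_root n (simple_gen n i a) (simple_gen n i b)"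
proof
  fix j
  have n: "int n \<ge> 2" using assms by simp
  have up: "affine_root n a b ((i + 1) mod n) = (b - 2 - int i) div int n - (a - 2 - int i) div int n"
  proof (cases "i + 1 < n")
    case True
    then show ?thesis by (simp add: affine_root_def algebra_simps)
  next
    case False
    then have e: "n = i + 1" using assms by simp
    have s: "(c - 1) div int n = (c - 2 - int i) div int n + 1" for c
      using div_add_self2[of "int n" "c - 2 - int i"] n by (simp add: e algebra_simps)
    show ?thesis using s[of a] s[of b] n by (simp add: affine_root_def e)
  qed
  have down: "affine_root n a b ((i + n - 1) mod n) = (b - int i) div int n - (a - int i) div int n"
  proof (cases "i = 0")
    case False
    then have "i + n - 1 = n + (i - 1)" by simp
    then have "(i + n - 1) mod n = i - 1" using assms by (simp only: mod_add_self1) simp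
    then show ?thesis using False assms by (simp add: affine_root_def of_nat_diff algebra_simps)
  next
    case True
    have s: "c div int n = (c - int n) div int n + 1" for c
      using div_add_self2[of "int n" "c - int n"] n by simp
    show ?thesis using s[of a] s[of b] True assms by (simp add: affine_root_def of_nat_diff algebra_simps)
  qed
  show "simple_refl n i (affine_root n a b) j = affine_root n (simple_gen n i a) (simple_gen n i b) j"
  proof (cases "j = i")
    case True
    have "simple_refl n i (affine_root n a b) i =
        affine_root n a b ((i + 1) mod n) + affine_root n a b ((i + n - 1) mod n) - affine_root n a b i"
      by (simp add: simple_refl_def)
    also have "\<dots> = affine_root n (simple_gen n i a) (simple_gen n i b) i"
      unfolding up down using assms
      by (simp add: affine_root_def simple_gen_div_same)
    finally show ?thesis using True by simp
  next
    case False
    then show ?thesis using assms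
      by (cases "j < n") (simp_all add: simple_refl_def affine_root_def simple_gen_div_other)
  qed
qed

lemma word_act_root:
  assumes "n \<ge> 2" "is_word n u"
  shows "word_act n u (affine_root n a b) = affine_root n (word_prod n u a) (word_prod n u b)"
  using assms(2)
proof (induction u)
  case Nil
  then show ?case by (simp add: word_act_def word_prod_def)
next
  case (Cons i u)
  then have "word_act n u (affine_root n a b) = affine_root n (word_prod n u a) (word_prod n u b)" "i < n"
    by (simp_all add: is_word_def)
  then show ?case using simple_refl_root[OF assms(1)]
    by (simp add: word_act_def word_prod_def)
qed

definition prefix_word :: "(nat \<Rightarrow> nat) \<Rightarrow> nat \<Rightarrow> nat list" where
  "prefix_word x k = map x [0..<k]"

definition infinite_reduced_word :: "nat \<Rightarrow> (nat \<Rightarrow> nat) \<Rightarrow> bool" where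
  "infinite_reduced_word n x \<longleftrightarrow>
     (\<forall>k. reduced_word n (word_prod n (prefix_word x k)) (prefix_word x k))"

definition Inv :: "nat \<Rightarrow> (nat \<Rightarrow> nat) \<Rightarrow> (nat \<Rightarrow> int) set" where
  "Inv n x = (\<Union>k. inversions n (prefix_word x k))"

definition braid_equiv :: "nat \<Rightarrow> ((nat \<Rightarrow> nat) \<times> (nat \<Rightarrow> nat)) set" where
  "braid_equiv n =
     {(x, y). infinite_reduced_word n x \<and> infinite_reduced_word n y \<and> Inv n x = Inv n y}"

definition braid_class :: "nat \<Rightarrow> (nat \<Rightarrow> nat) \<Rightarrow> (nat \<Rightarrow> nat) set" where
  "braid_class n x = braid_equiv n `` {x}"

definition limit_classes :: "nat \<Rightarrow> (nat \<Rightarrow> nat) set set" where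
  "limit_classes n = {x. infinite_reduced_word n x} // braid_equiv n"

definition limit_weak_le :: "nat \<Rightarrow> (nat \<Rightarrow> nat) set \<Rightarrow> (nat \<Rightarrow> nat) set \<Rightarrow> bool" where
  "limit_weak_le n X Y \<longleftrightarrow> (\<forall>x\<in>X. \<forall>y\<in>Y. Inv n x \<subseteq> Inv n y)"

definition limit_weak_minimal :: "nat \<Rightarrow> (nat \<Rightarrow> nat) set \<Rightarrow> bool" where
  "limit_weak_minimal n X \<longleftrightarrow>
     X \<in> limit_classes n \<and> (\<forall>Y\<in>limit_classes n. limit_weak_le n Y X \<longrightarrow> Y = X)"

definition coxeter_word :: "nat \<Rightarrow> (int \<Rightarrow> int) \<Rightarrow> nat list \<Rightarrow> bool" where
  "coxeter_word n c u \<longleftrightarrow> reduced_word n c u \<and> distinct u \<and> set u = {..<n}"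

definition coxeter_element :: "nat \<Rightarrow> (int \<Rightarrow> int) \<Rightarrow> bool" where
  "coxeter_element n c \<longleftrightarrow> c \<in> affine_symmetric_group n \<and> (\<exists>u. coxeter_word n c u)"

definition repeat_word :: "nat list \<Rightarrow> nat \<Rightarrow> nat" where
  "repeat_word u k = u ! (k mod length u)"

text \<open>\<open>braid_move n x y\<close>: the infinite word \<open>y\<close> arises from \<open>x\<close> by one three-term braid move,
  in either direction. For \<open>n = 2\<close> the group has no braid relation
  (\<open>s\<^sub>0 s\<^sub>1\<close> has infinite order), hence there are no braid moves.\<close>

definition braid_move :: "nat \<Rightarrow> (nat \<Rightarrow> nat) \<Rightarrow> (nat \<Rightarrow> nat) \<Rightarrow> bool" where
  "braid_move n x y \<longleftrightarrow> n \<ge> 3 \<and>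
     (\<exists>k a b. a < n \<and> b < n \<and> (b = (a + 1) mod n \<or> a = (b + 1) mod n) \<and>
        x k = a \<and> x (k + 1) = b \<and> x (k + 2) = a \<and>
        y = x(k := b, k + 1 := a, k + 2 := b))"

definition fully_commutative :: "nat \<Rightarrow> (nat \<Rightarrow> nat) set \<Rightarrow> bool" where
  "fully_commutative n X \<longleftrightarrow> \<not> (\<exists>x\<in>X. \<exists>y. braid_move n x y)"

end

theory Submission
  imports Defs
begin

text \<open>Read a word as a process on a line of particles labelled by the integers: the letter \<open>i\<close> swaps
  the particles in positions \<open>i\<close> and \<open>i + 1\<close> (and all their translates by multiples of \<open>n\<close>). The word
  is reduced iff every step swaps a pair that stands in its original order, and the inversion set of
  an infinite reduced word is the set of pairs \<open>a < b\<close> that eventually get swapped. Such a set is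
  translation invariant, biconvex, and infinite modulo translations.

  In \<open>c\<^sup>\<infinity>\<close> every particle either always moves right or always moves left, so the inversion set is
  \<open>I\<^sub>R = {(a, b). a < b, a \<in> R, b \<notin> R}\<close>, where \<open>R\<close> is the set of right movers; every proper nonempty
  union \<open>R\<close> of residue classes arises in this way. For an arbitrary inversion set \<open>I\<close>, pigeonhole gives a
  residue class \<open>r\<close> such that some particle crosses infinitely many members of it, and taking for \<open>R\<close>
  the particles that cross all members of \<open>r\<close> to their right, biconvexity yields \<open>I\<^sub>R \<subseteq> I\<close>.
  Conversely an infinite biconvex subset of \<open>I\<^sub>R\<close> is all of \<open>I\<^sub>R\<close>; hence the minimal sets are the \<open>I\<^sub>R\<close>.
  A class is fully commutative iff no \<open>a < b < c\<close> are pairwise swapped, and among the \<open>I \<supseteq> I\<^sub>R\<close>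
  only \<open>I\<^sub>R\<close> itself has this property.\<close>

section \<open>Words as particle processes\<close>

lemma word_prod_Nil [simp]: "word_prod n [] = id"
  by (simp add: word_prod_def)

lemma word_prod_Cons [simp]: "word_prod n (i # u) = simple_gen n i \<circ> word_prod n u"
  by (simp add: word_prod_def)

lemma word_prod_append [simp]: "word_prod n (u @ v) = word_prod n u \<circ> word_prod n v"
  by (induction u) (auto simp: comp_assoc)

text \<open>\<open>word_pos n u a\<close> is the position of particle \<open>a\<close> after the moves in \<open>u\<close>; \<open>word_prod n u p\<close>
  is the particle in position \<open>p\<close>.\<close>

definition word_pos :: "nat \<Rightarrow> nat list \<Rightarrow> int \<Rightarrow> int" where
  "word_pos n u = word_prod n (rev u)"

lemma word_pos_simps [simp]:
  "word_pos n [] = id" "word_pos n (u @ [i]) = simple_gen n i \<circ> word_pos n u"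
  by (simp_all add: word_pos_def)

lemma prefix_word_simps [simp]:
  "prefix_word x 0 = []" "prefix_word x (Suc k) = prefix_word x k @ [x k]"
  "length (prefix_word x k) = k"
  by (simp_all add: prefix_word_def)

lemma take_prefix_word: "m \<le> k \<Longrightarrow> take m (prefix_word x k) = prefix_word x m"
  by (simp add: prefix_word_def take_map)

lemma is_word_simps [simp]:
  "is_word n []" "is_word n (i # u) \<longleftrightarrow> i < n \<and> is_word n u"
  "is_word n (u @ v) \<longleftrightarrow> is_word n u \<and> is_word n v" "is_word n (rev u) \<longleftrightarrow> is_word n u"
  by (auto simp: is_word_def)

lemma reduced_word_le:
  assumes "reduced_word n w u" "is_word n v" "word_prod n v = w"
  shows "length u \<le> length v"
  using assms unfolding reduced_word_def cox_length_def by (auto intro!: Least_le)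

lemma reduced_wordI:
  assumes "is_word n u" "word_prod n u = w"
    and "\<And>v. is_word n v \<Longrightarrow> word_prod n v = w \<Longrightarrow> length u \<le> length v"
  shows "reduced_word n w u"
proof -
  have "cox_length n w = length u"
    unfolding cox_length_def by (rule Least_equality) (use assms in auto)
  with assms show ?thesis by (simp add: reduced_word_def)
qed

lemma reduced_word_exists:
  assumes "is_word n v"
  shows "\<exists>u. reduced_word n (word_prod n v) u"
proof -
  let ?P = "\<lambda>u. is_word n u \<and> word_prod n u = word_prod n v"
  have "?P (ARG_MIN length u. ?P u)" "\<And>u. ?P u \<Longrightarrow> length (ARG_MIN length u. ?P u) \<le> length u"
    using assms by (auto intro: arg_min_nat_le dest: arg_min_natI[of ?P v])
      (metis (mono_tags, lifting) arg_min_natI)+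
  then show ?thesis using reduced_wordI[of n "ARG_MIN length u. ?P u"] by blast
qed

lemma affine_root_shift: "affine_root n (a + c * int n) (b + c * int n) = affine_root n a b"
proof
  fix j
  show "affine_root n (a + c * int n) (b + c * int n) j = affine_root n a b j"
  proof (cases "j < n")
    case True
    then have "(t + c * int n) div int n = t div int n + c" for t by simp
    from this[of "a - 1 - int j"] this[of "b - 1 - int j"] show ?thesis
      using True by (simp add: affine_root_def algebra_simps)
  qed (simp add: affine_root_def)
qed

lemma div_step:
  assumes "int n > 0"
  shows "b div int n - (b - 1) div int n = (if int n dvd b then 1 else 0)"
proof (cases "int n dvd b")
  case True
  then obtain k where b: "b = int n * k" by blast
  have "(b - 1) div int n = k - 1"
    by (rule int_div_pos_eq[where r = "int n - 1"]) (use assms b in \<open>auto simp: algebra_simps\<close>)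
  then show ?thesis using assms b by simp
next
  case False
  then have "b mod int n \<noteq> 0" by (simp add: dvd_eq_mod_eq_0)
  then have r: "1 \<le> b mod int n" "b mod int n < int n" using assms pos_mod_sign[of "int n" b] pos_mod_bound[of "int n" b] by linarith+
  have "(b - 1) div int n = b div int n"
    by (rule int_div_pos_eq[where r = "b mod int n - 1"]) (use r in \<open>auto simp: algebra_simps\<close>)
  then show ?thesis using False by simp
qed

section \<open>Generators as periodic permutations of the integers\<close>

locale affine_rank =
  fixes n :: nat
  assumes n2: "n \<ge> 2"
begin

lemma cong_next: "p mod int n = (q :: int) mod int n \<longleftrightarrow> (p + 1) mod int n = (q + 1) mod int n"
  by (simp add: mod_eq_dvd_iff)

lemma not_cong_next: "p mod int n = q mod int n \<Longrightarrow> (p + 1) mod int n \<noteq> q mod int n"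
proof
  assume "p mod int n = q mod int n" "(p + 1) mod int n = q mod int n"
  then have "int n dvd (p + 1) - q - (p - q)"
    unfolding mod_eq_dvd_iff by (metis dvd_diff)
  then show False using n2 by simp
qed

lemma simple_gen_alt:
  "simple_gen n i p = (if p mod int n = int i mod int n then p + 1
     else if (p - 1) mod int n = int i mod int n then p - 1 else p)"
  using cong_next[of "p - 1" "int i"] by (simp add: simple_gen_def)

lemma simple_gen_here: "p mod int n = int i mod int n \<Longrightarrow> simple_gen n i p = p + 1"
  by (simp add: simple_gen_alt)

lemma simple_gen_next: "p mod int n = int i mod int n \<Longrightarrow> simple_gen n i (p + 1) = p"
  using not_cong_next by (simp add: simple_gen_alt)

lemma simple_gen_invol [simp]: "simple_gen n i (simple_gen n i p) = p"
  using not_cong_next[of p "int i"] not_cong_next[of "p - 1" "int i"] by (auto simp: simple_gen_alt)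

lemma simple_gen_shift [simp]: "simple_gen n i (p + c * int n) = simple_gen n i p + c * int n"
proof -
  have "(p + c * int n - 1) mod int n = (p - 1) mod int n"
    using mod_mult_self1[of "p - 1" c "int n"] by (simp add: algebra_simps)
  then show ?thesis by (simp add: simple_gen_alt)
qed

lemma simple_gen_less:
  assumes "p < q"
  shows "simple_gen n i p < simple_gen n i q \<or> (q = p + 1 \<and> p mod int n = int i mod int n)"
  using assms not_cong_next[of p "int i"] not_cong_next[of "p - 1" "int i"]
    not_cong_next[of "q - 1" "int i"]
  by (auto simp: simple_gen_alt split: if_splits) (smt (verit))+

lemma word_prod_shift [simp]: "word_prod n u (p + c * int n) = word_prod n u p + c * int n"
  by (induction u) auto

lemma word_pos_shift [simp]: "word_pos n u (p + c * int n) = word_pos n u p + c * int n"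
  by (simp add: word_pos_def)

lemma word_pos_prod [simp]: "word_pos n u (word_prod n u p) = p"
  by (induction u arbitrary: p) (auto simp: word_pos_def)

lemma word_prod_pos [simp]: "word_prod n u (word_pos n u p) = p"
  using word_pos_prod[of "rev u"] by (simp add: word_pos_def)

lemma word_prod_inject [simp]: "word_prod n u p = word_prod n u q \<longleftrightarrow> p = q"
  by (metis word_pos_prod)

lemma word_pos_inject [simp]: "word_pos n u p = word_pos n u q \<longleftrightarrow> p = q"
  by (metis word_prod_pos)

lemma word_pos_cong: "word_prod n u = word_prod n v \<Longrightarrow> word_pos n u = word_pos n v"
  by (metis ext word_prod_pos word_prod_inject)

lemma affine_root_inject:
  assumes eq: "affine_root n a b = affine_root n c d" and nd: "\<not> int n dvd b - a"
  shows "\<exists>k. c = a + k * int n \<and> d = b + k * int n"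
proof -
  \<comment> \<open>On all integers \<open>j\<close>, the coefficients of a root jump exactly at the classes of \<open>a\<close> and \<open>b\<close>.\<close>
  define g where "g a b j = (b - 1 - j) div int n - (a - 1 - j) div int n" for a b j :: int
  have n0: "int n > 0" using n2 by simp
  have gs: "g a b (j + k * int n) = g a b j" for a b j k
  proof -
    have "(t + l * int n) div int n = t div int n + l" for t l using n0 by simp
    from this[of "b - 1 - j" "- k"] this[of "a - 1 - j" "- k"] show ?thesis by (simp add: g_def algebra_simps)
  qed
  have gg: "g a b j = affine_root n a b (nat (j mod int n))" for a b j
  proof -
    have "nat (j mod int n) < n" using n0 by (simp add: nat_less_iff)
    then have "affine_root n a b (nat (j mod int n)) = g a b (j mod int n)"
      using n0 by (simp add: affine_root_def g_def)
    also have "\<dots> = g a b (j mod int n + (j div int n) * int n)" by (simp only: gs)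
    also have "j mod int n + (j div int n) * int n = j" by simp
    finally show ?thesis by simp
  qed
  have ge: "g a b j = g c d j" for j using eq by (simp add: gg)
  have gd: "g a b (j - 1) - g a b j = (if int n dvd b - j then 1 else 0) - (if int n dvd a - j then 1 else 0)" for a b j
    using div_step[OF n0, of "b - j"] div_step[OF n0, of "a - j"] by (simp add: g_def algebra_simps)
  \<comment> \<open>The jump at \<open>j = b\<close> is 1, as \<open>nd\<close> rules out
    cancellation by \<open>a\<close>; for the second root only the class of \<open>d\<close> can
    produce it.\<close>
  have "int n dvd d - b"
    using gd[of a b b] gd[of c d b] nd ge by (auto split: if_splits simp: dvd_diff_commute)
  then obtain k where k: "d = b + k * int n" by (metis add_diff_cancel_left' dvdE mult.commute diff_add_cancel add.commute)
  have "int n dvd c - a"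
    using gd[of a b a] gd[of c d a] nd ge by (auto split: if_splits simp: dvd_diff_commute)
  then obtain l where l: "c = a + l * int n" by (metis add_diff_cancel_left' dvdE mult.commute diff_add_cancel add.commute)
  \<comment> \<open>So far the two endpoints may be shifted differently; the coefficient at 0
    changes by \<open>k - l\<close>, which forces \<open>k = l\<close>.\<close>
  have "(b - 1 + k * int n) div int n = (b - 1) div int n + k"
    "(a - 1 + l * int n) div int n = (a - 1) div int n + l" using n0 by simp_all
  then have "g c d 0 = g a b 0 + k - l" by (simp add: g_def k l algebra_simps)
  then show ?thesis using ge k l by auto
qed

lemma mod_eq_shift: "(p :: int) mod int n = q mod int n \<Longrightarrow> \<exists>c. p = q + c * int n"
  by (metis add.commute diff_add_cancel dvd_def mod_eq_dvd_iff mult.commute)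

lemma word_prod_not_cong: "\<not> int n dvd word_prod n u (p + 1) - word_prod n u p"
proof
  assume "int n dvd word_prod n u (p + 1) - word_prod n u p"
  then obtain c where "word_prod n u (p + 1) = word_prod n u p + c * int n"
    using mod_eq_shift by (metis mod_eq_dvd_iff)
  then have "word_prod n u (p + 1) = word_prod n u (p + c * int n)" by simp
  then have "1 = c * int n" by (simp only: word_prod_inject)
  then show False using n2 by (simp add: zmult_eq_1_iff)
qed

text \<open>Conjugating the swap of \<open>p\<close> and \<open>p + 1\<close> by \<open>v\<close>
  gives the swap of their images. This cancels two letters in the exchange argument.\<close>

lemma simple_gen_conj:
  assumes "word_prod n v p = q" "word_prod n v (p + 1) = q + 1"
    and i: "p mod int n = int i mod int n" and j: "q mod int n = int j mod int n"
  shows "simple_gen n j (word_prod n v (simple_gen n i x)) = word_prod n v x"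
proof -
  consider (1) "x mod int n = int i mod int n" | (2) "(x - 1) mod int n = int i mod int n"
    | (3) "x mod int n \<noteq> int i mod int n" "(x - 1) mod int n \<noteq> int i mod int n" by blast
  then show ?thesis
  proof cases
    case 1
    then obtain c where c: "x = p + c * int n" using i mod_eq_shift by metis
    have "simple_gen n i x = (p + 1) + c * int n" using 1 c by (simp add: simple_gen_here)
    then have "word_prod n v (simple_gen n i x) = (q + 1) + c * int n"
      using assms by (simp only: word_prod_shift)
    then show ?thesis using simple_gen_next[OF j] assms c by (simp only: simple_gen_shift word_prod_shift)
  next
    case 2
    then obtain c where c: "x - 1 = p + c * int n" using i mod_eq_shift by metis
    then have c': "x = (p + 1) + c * int n" by simp
    have "simple_gen n i x = p + c * int n"
      using simple_gen_next[OF i] c' by (simp only: simple_gen_shift)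
    then have "word_prod n v (simple_gen n i x) = q + c * int n"
      using assms by (simp only: word_prod_shift)
    then show ?thesis using simple_gen_here[OF j] assms c' by (simp only: simple_gen_shift word_prod_shift)
  next
    case 3
    have "word_prod n v x mod int n \<noteq> int j mod int n"
    proof
      assume "word_prod n v x mod int n = int j mod int n"
      then obtain c where "word_prod n v x = q + c * int n" using j mod_eq_shift by metis
      then have "word_prod n v x = word_prod n v (p + c * int n)" using assms by simp
      then have "x = p + c * int n" by (simp only: word_prod_inject)
      then show False using 3 i by simp
    qed
    moreover have "(word_prod n v x - 1) mod int n \<noteq> int j mod int n"
    proof
      assume "(word_prod n v x - 1) mod int n = int j mod int n"
      then obtain c where "word_prod n v x - 1 = q + c * int n" using j mod_eq_shift by metis
      then have "word_prod n v x = word_prod n v ((p + 1) + c * int n)"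
        using assms by (simp only: word_prod_shift)
      then have "x = (p + 1) + c * int n" by (simp only: word_prod_inject)
      then have "x - 1 = p + c * int n" by simp
      then show False using 3 i by simp
    qed
    ultimately show ?thesis using 3 by (simp add: simple_gen_alt)
  qed
qed

section \<open>Crossings of particles and ascending words\<close>

lemma crossing_step:
  assumes "word_pos n u a < word_pos n u b" "\<not> word_pos n (u @ [i]) a < word_pos n (u @ [i]) b"
  shows "word_pos n u b = word_pos n u a + 1" "word_pos n u a mod int n = int i mod int n"
  using simple_gen_less[OF assms(1), of i] assms(2) by auto

lemma crossing_exists:
  assumes "a < b" "word_pos n u b < word_pos n u a"
  shows "\<exists>m<length u. word_pos n (take m u) b = word_pos n (take m u) a + 1
    \<and> word_pos n (take m u) a mod int n = int (u ! m) mod int n"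
  using assms(2)
proof (induction u rule: rev_induct)
  case Nil
  then show ?case using assms by simp
next
  case (snoc i u)
  show ?case
  proof (cases "word_pos n u b < word_pos n u a")
    case True
    then obtain m where "m < length u" "word_pos n (take m u) b = word_pos n (take m u) a + 1"
      "word_pos n (take m u) a mod int n = int (u ! m) mod int n" using snoc.IH by blast
    then show ?thesis by (intro exI[of _ m]) (auto simp: nth_append)
  next
    case False
    then have "word_pos n u a < word_pos n u b" using assms(1) by (simp add: not_less less_le)
    then show ?thesis using crossing_step[of u a b i] snoc.prems
      by (intro exI[of _ "length u"]) auto
  qed
qed

text \<open>Local form of reducedness: each letter is a right ascent, \<open>w(i) < w(i+1)\<close>,
  of the product \<open>w\<close> of the letters before it.\<close>

definition ascending :: "nat list \<Rightarrow> bool" where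
  "ascending u \<longleftrightarrow> (\<forall>m<length u. word_prod n (take m u) (int (u ! m)) < word_prod n (take m u) (int (u ! m) + 1))"

lemma ascending_Nil [simp]: "ascending []"
  by (simp add: ascending_def)

lemma ascending_snoc [simp]:
  "ascending (u @ [i]) \<longleftrightarrow> ascending u \<and> word_prod n u (int i) < word_prod n u (int i + 1)"
  by (auto simp: ascending_def nth_append less_Suc_eq)

lemma ascending_appendD: "ascending (u @ v) \<Longrightarrow> ascending u"
  by (induction v rule: rev_induct) (auto simp flip: append_assoc)

lemma ascent_cong:
  assumes "p mod int n = int i mod int n"
  shows "word_prod n u p < word_prod n u (p + 1) \<longleftrightarrow> word_prod n u (int i) < word_prod n u (int i + 1)"
proof -
  obtain c where c: "p = int i + c * int n" using assms mod_eq_shift by metis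
  then have "p + 1 = (int i + 1) + c * int n" by simp
  with c show ?thesis by (simp only: word_prod_shift) simp
qed

text \<open>A step undoing the crossing would swap adjacent particles with the larger label on the
  left, which is a descent.\<close>

lemma ascending_crossed_snoc:
  assumes "ascending (u @ [i])" "a < b" "word_pos n u b < word_pos n u a"
  shows "word_pos n (u @ [i]) b < word_pos n (u @ [i]) a"
proof (rule ccontr)
  assume "\<not> ?thesis"
  from crossing_step[OF assms(3) this] ascent_cong[of "word_pos n u b" i u] assms(1)
  have "word_prod n u (word_pos n u b) < word_prod n u (word_pos n u a)" by simp
  then show False using assms(2) by (simp only: word_prod_pos)
qed

lemma ascending_crossed:
  assumes "ascending (u @ v)" "a < b" "word_pos n u b < word_pos n u a"
  shows "word_pos n (u @ v) b < word_pos n (u @ v) a"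
  using assms(1)
proof (induction v rule: rev_induct)
  case Nil
  then show ?case using assms by simp
next
  case (snoc i v)
  have as: "ascending ((u @ v) @ [i])" using snoc.prems by simp
  with ascending_crossed_snoc[OF as assms(2)] snoc.IH ascending_appendD[OF as] show ?case by simp
qed

text \<open>Exchange condition: a step that undoes an earlier swap of the same two particles can be deleted
  together with that swap.\<close>

lemma reduced_imp_ascending:
  assumes "reduced_word n (word_prod n u) u"
  shows "ascending u"
proof (rule ccontr)
  assume "\<not> ascending u"
  then obtain k where k: "k < length u"
    and "\<not> word_prod n (take k u) (int (u ! k)) < word_prod n (take k u) (int (u ! k) + 1)"
    by (auto simp: ascending_def)
  define i where "i = u ! k"
  \<comment> \<open>At step \<open>k\<close>, \<open>b\<close> stands directly left of
    \<open>a\<close> although \<open>a < b\<close>, so the two have already crossed, at some step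
    \<open>m\<close>.\<close>
  define a where "a = word_prod n (take k u) (int i + 1)"
  define b where "b = word_prod n (take k u) (int i)"
  have "a < b"
    using \<open>\<not> _ < _\<close> word_prod_inject[of "take k u" "int i" "int i + 1"] by (simp add: a_def b_def i_def not_less less_le)
  moreover have "word_pos n (take k u) b < word_pos n (take k u) a" by (simp add: a_def b_def)
  ultimately obtain m where "m < length (take k u)"
    and m: "word_pos n (take m (take k u)) b = word_pos n (take m (take k u)) a + 1"
      "word_pos n (take m (take k u)) a mod int n = int (take k u ! m) mod int n"
    using crossing_exists by blast
  then have mk: "m < k" by simp
  define j A B C where "j = u ! m" and "A = take m u" and "B = drop (Suc m) (take k u)" and "C = drop (Suc k) u"
  define q where "q = word_pos n A a"
  have m': "word_pos n A b = q + 1" "q mod int n = int j mod int n"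
    using m mk by (simp_all add: A_def q_def j_def)
  have tk: "take k u = (A @ [j]) @ B"
    unfolding A_def B_def j_def using mk k
    by (metis append_take_drop_id less_trans min.absorb1 nth_take order_less_imp_le Suc_leI take_Suc_conv_app_nth take_take)
  have u: "u = A @ [j] @ B @ [i] @ C"
    using tk id_take_nth_drop[OF k] by (simp add: i_def C_def)
  \<comment> \<open>\<open>word_prod n B\<close> sends positions at time \<open>k\<close> to those
    of the same particles just after step \<open>m\<close>; so \<open>i\<close>,
    \<open>i + 1\<close> go to \<open>q\<close>, \<open>q + 1\<close>, and
    \<open>simple_gen_conj\<close> cancels \<open>j\<close> against \<open>i\<close>.\<close>
  have v: "word_prod n B p = word_pos n (A @ [j]) (word_prod n (take k u) p)" for p
    unfolding tk word_prod_append[of n "A @ [j]" B] comp_apply by (rule word_pos_prod[symmetric])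
  have "word_prod n B (int i) = q"
    using m' simple_gen_next[of q j] unfolding v b_def[symmetric] by simp
  moreover have "word_prod n B (int i + 1) = q + 1"
    using m' simple_gen_here[of q j] unfolding v a_def[symmetric] by (simp add: q_def)
  ultimately have *: "simple_gen n j (word_prod n B (simple_gen n i x)) = word_prod n B x" for x
    by (rule simple_gen_conj[where p = "int i" and q = q]) (use m' in auto)
  have "word_prod n u = word_prod n (A @ [j] @ B @ [i] @ C)" using u by (rule arg_cong)
  then have "word_prod n (A @ B @ C) = word_prod n u" by (auto simp: * fun_eq_iff)
  moreover have "is_word n (A @ [j] @ B @ [i] @ C)"
    using assms by (simp only: u[symmetric] reduced_word_def)
  then have "is_word n (A @ B @ C)" by simp
  ultimately have "length u \<le> length (A @ B @ C)"
    using reduced_word_le[OF assms] by blast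
  moreover have "length u = length (A @ [j] @ B @ [i] @ C)" using u by (rule arg_cong)
  ultimately show False by simp
qed

section \<open>Counting inversions and the ascent criterion for reducedness\<close>

definition step_root :: "nat list \<Rightarrow> nat \<Rightarrow> nat \<Rightarrow> int" where
  "step_root u i = affine_root n (word_prod n u (int i)) (word_prod n u (int i + 1))"

lemma inversions_eq:
  assumes "is_word n u"
  shows "inversions n u = (\<lambda>m. step_root (take m u) (u ! m)) ` {..<length u}"
proof -
  have "word_act n (take m u) (simple_root (u ! m)) = step_root (take m u) (u ! m)" if "m < length u" for m
  proof -
    have "u ! m < n" "is_word n (take m u)"
      using assms that set_take_subset[of m u] nth_mem[of m u] unfolding is_word_def by blast+
    then show ?thesis using n2 by (simp add: simple_root_eq_root word_act_root step_root_def)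
  qed
  then show ?thesis unfolding inversions_def by force
qed

text \<open>Equal roots at steps \<open>m < k\<close> would mean that step \<open>k\<close> swaps a
  translate of the pair swapped at step \<open>m\<close>. That pair has stayed crossed since,
  whereas an ascending word swaps only pairs in their original order.\<close>

lemma card_inversions:
  assumes "is_word n u" "ascending u"
  shows "card (inversions n u) = length u"
proof -
  have "step_root (take m u) (u ! m) \<noteq> step_root (take k u) (u ! k)" if "m < k" "k < length u" for m k
  proof
    define a b where "a = word_prod n (take m u) (int (u ! m))"
      and "b = word_prod n (take m u) (int (u ! m) + 1)"
    assume "step_root (take m u) (u ! m) = step_root (take k u) (u ! k)"
    then obtain l where l: "word_prod n (take k u) (int (u ! k)) = a + l * int n"
        "word_prod n (take k u) (int (u ! k) + 1) = b + l * int n"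
      unfolding step_root_def a_def b_def using affine_root_inject word_prod_not_cong by blast
    have "a < b" using assms that by (simp add: ascending_def a_def b_def)
    have *: "take (Suc m) u = take m u @ [u ! m]" using that by (simp add: take_Suc_conv_app_nth)
    have "word_pos n (take (Suc m) u) b < word_pos n (take (Suc m) u) a"
      unfolding * a_def b_def by (simp add: simple_gen_here simple_gen_next)
    moreover have tk: "take k u = take (Suc m) u @ drop (Suc m) (take k u)"
      using that by (metis append_take_drop_id min.absorb1 Suc_leI take_take)
    moreover have "ascending (take k u)"
      using assms ascending_appendD[of "take k u" "drop k u"] by simp
    ultimately have "word_pos n (take k u) b < word_pos n (take k u) a"
      using ascending_crossed[of "take (Suc m) u" "drop (Suc m) (take k u)" a b] \<open>a < b\<close> by simp
    moreover have "word_pos n (take k u) (a + l * int n) = int (u ! k)"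
      "word_pos n (take k u) (b + l * int n) = int (u ! k) + 1"
      unfolding l[symmetric] by simp_all
    ultimately show False by simp
  qed
  then have "inj_on (\<lambda>m. step_root (take m u) (u ! m)) {..<length u}"
    by (intro linorder_inj_onI) auto
  then show ?thesis using assms by (simp add: inversions_eq card_image)
qed

lemma root_in_inversions:
  assumes "is_word n u" "a < b" "word_pos n u b < word_pos n u a"
  shows "affine_root n a b \<in> inversions n u"
proof -
  obtain m where m: "m < length u" "word_pos n (take m u) b = word_pos n (take m u) a + 1"
    "word_pos n (take m u) a mod int n = int (u ! m) mod int n"
    using crossing_exists[OF assms(2,3)] by blast
  then obtain c where c: "word_pos n (take m u) a = int (u ! m) + c * int n" using mod_eq_shift by blast
  then have d: "word_pos n (take m u) b = (int (u ! m) + 1) + c * int n" using m by simp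
  have "a = word_prod n (take m u) (int (u ! m)) + c * int n"
    "b = word_prod n (take m u) (int (u ! m) + 1) + c * int n"
    by (metis c word_prod_pos word_prod_shift) (metis d word_prod_pos word_prod_shift)
  then have "affine_root n a b = step_root (take m u) (u ! m)" by (simp add: step_root_def affine_root_shift)
  then show ?thesis using m assms by (auto simp: inversions_eq)
qed

text \<open>A swapped pair stays crossed to the end, so the inversions depend only on the final
  positions, hence on the group element.\<close>

lemma inversions_ascending:
  assumes "is_word n u" "ascending u"
  shows "inversions n u = {affine_root n a b |a b. a < b \<and> word_pos n u b < word_pos n u a}"
proof
  show "inversions n u \<subseteq> {affine_root n a b |a b. a < b \<and> word_pos n u b < word_pos n u a}"
  proof
    fix r assume "r \<in> inversions n u"
    then obtain m where m: "m < length u" "r = step_root (take m u) (u ! m)"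
      using assms by (auto simp: inversions_eq)
    define a b where "a = word_prod n (take m u) (int (u ! m))"
      and "b = word_prod n (take m u) (int (u ! m) + 1)"
    have "a < b" using assms m by (simp add: ascending_def a_def b_def)
    have *: "take (Suc m) u = take m u @ [u ! m]" using m by (simp add: take_Suc_conv_app_nth)
    have "word_pos n (take (Suc m) u) b < word_pos n (take (Suc m) u) a"
      unfolding * a_def b_def by (simp add: simple_gen_here simple_gen_next)
    then have "word_pos n u b < word_pos n u a"
      using ascending_crossed[of "take (Suc m) u" "drop (Suc m) u" a b] \<open>a < b\<close> assms by simp
    then show "r \<in> {affine_root n a b |a b. a < b \<and> word_pos n u b < word_pos n u a}"
      using m \<open>a < b\<close> by (auto simp: step_root_def a_def b_def)
  qed
qed (use assms root_in_inversions in auto)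

text \<open>A competitor \<open>v\<close> with the same product crosses the same pairs, so its
  inversions include those of \<open>u\<close>, of which there are \<open>length u\<close>. The
  other direction is the exchange argument.\<close>

lemma reduced_iff_ascending:
  assumes "is_word n u"
  shows "reduced_word n (word_prod n u) u \<longleftrightarrow> ascending u"
proof
  assume as: "ascending u"
  show "reduced_word n (word_prod n u) u"
  proof (rule reduced_wordI)
    fix v assume v: "is_word n v" "word_prod n v = word_prod n u"
    have "inversions n u \<subseteq> inversions n v"
      using inversions_ascending[OF assms as] root_in_inversions[OF v(1)] word_pos_cong[OF v(2)] by auto
    then have "card (inversions n u) \<le> card (inversions n v)"
      by (rule card_mono[rotated]) (simp add: inversions_eq v)
    also have "\<dots> \<le> card {..<length v}"
      unfolding inversions_eq[OF v(1)] by (rule card_image_le) simp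
    finally show "length u \<le> length v" using card_inversions[OF assms as] by simp
  qed (use assms in auto)
qed (use reduced_imp_ascending in blast)

section \<open>Inversion sets of infinite reduced words\<close>

lemma prefix_word_append: "k \<le> m \<Longrightarrow> \<exists>v. prefix_word x m = prefix_word x k @ v"
  by (metis append_take_drop_id take_prefix_word)

lemma infinite_reducedD:
  assumes "infinite_reduced_word n x"
  shows "x k < n" "is_word n (prefix_word x k)" "ascending (prefix_word x k)"
    "word_prod n (prefix_word x k) (int (x k)) < word_prod n (prefix_word x k) (int (x k) + 1)"
proof -
  have *: "is_word n (prefix_word x k) \<and> ascending (prefix_word x k)" for k
    using assms reduced_iff_ascending unfolding infinite_reduced_word_def reduced_word_def by blast
  show "x k < n" "is_word n (prefix_word x k)" "ascending (prefix_word x k)"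
    "word_prod n (prefix_word x k) (int (x k)) < word_prod n (prefix_word x k) (int (x k) + 1)"
    using *[of k] *[of "Suc k"] by simp_all
qed

lemma infinite_reducedI:
  assumes "\<And>k. x k < n"
    and "\<And>k. word_prod n (prefix_word x k) (int (x k)) < word_prod n (prefix_word x k) (int (x k) + 1)"
  shows "infinite_reduced_word n x"
proof -
  have "is_word n (prefix_word x k) \<and> ascending (prefix_word x k)" for k
    by (induction k) (use assms in auto)
  then show ?thesis using reduced_iff_ascending by (auto simp: infinite_reduced_word_def)
qed

text \<open>The inversion set lifted from roots to pairs of particles: on pairs, biconvexity becomes
  a statement about linear orders.\<close>

definition crossings :: "(nat \<Rightarrow> nat) \<Rightarrow> (int \<times> int) set" where
  "crossings x = {(a, b). a < b \<and>
     (\<exists>k. word_pos n (prefix_word x k) b < word_pos n (prefix_word x k) a)}"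

lemma crossed_mono:
  assumes "infinite_reduced_word n x" "a < b" "k \<le> m"
    and "word_pos n (prefix_word x k) b < word_pos n (prefix_word x k) a"
  shows "word_pos n (prefix_word x m) b < word_pos n (prefix_word x m) a"
  using prefix_word_append[OF assms(3)] ascending_crossed assms infinite_reducedD(3) by metis

lemma Inv_eq:
  assumes "infinite_reduced_word n x"
  shows "Inv n x = {affine_root n a b |a b. (a, b) \<in> crossings x}"
  unfolding Inv_def crossings_def using inversions_ascending infinite_reducedD[OF assms] by auto

lemma infinite_Inv:
  assumes "infinite_reduced_word n x"
  shows "infinite (Inv n x)"
proof
  assume fin: "finite (Inv n x)"
  have "k \<le> card (Inv n x)" for k
  proof -
    have "card (inversions n (prefix_word x k)) \<le> card (Inv n x)"
      by (rule card_mono[OF fin]) (auto simp: Inv_def)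
    then show ?thesis using card_inversions infinite_reducedD[OF assms] by simp
  qed
  then show False by (metis not_less_eq_eq)
qed

lemma step_in_crossings:
  assumes "infinite_reduced_word n x" "p mod int n = int (x k) mod int n"
  shows "(word_prod n (prefix_word x k) p, word_prod n (prefix_word x k) (p + 1)) \<in> crossings x"
proof -
  let ?a = "word_prod n (prefix_word x k) p" and ?b = "word_prod n (prefix_word x k) (p + 1)"
  have "?a < ?b" using ascent_cong[OF assms(2)] infinite_reducedD(4)[OF assms(1)] by simp
  moreover have "word_pos n (prefix_word x (Suc k)) ?b < word_pos n (prefix_word x (Suc k)) ?a"
    using simple_gen_here[OF assms(2)] simple_gen_next[OF assms(2)] by simp
  ultimately show ?thesis unfolding crossings_def by blast
qed

lemma ex_shift_less: "\<exists>c. p + c * int n < q"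
proof -
  define d where "d = \<bar>p\<bar> + \<bar>q\<bar> + 1"
  have "d * 1 \<le> d * int n" using n2 by (intro mult_left_mono) (auto simp: d_def)
  moreover have "p - d < q" by (simp add: d_def)
  ultimately have "p + (- d) * int n < q" by simp
  then show ?thesis by blast
qed

lemma ex_shift_greater: "\<exists>c. q < p + c * int n"
proof -
  obtain c where "- p + c * int n < - q" using ex_shift_less by blast
  then show ?thesis by (intro exI[of _ "- c"]) simp
qed

section \<open>Rigidity of infinite biconvex sets of pairs\<close>

definition split_pairs :: "int set \<Rightarrow> (int \<times> int) set" where
  "split_pairs R = {(a, b). a < b \<and> a \<in> R \<and> b \<notin> R}"

definition shift_closed :: "int set \<Rightarrow> bool" where
  "shift_closed R \<longleftrightarrow> (\<forall>a c. a + c * int n \<in> R \<longleftrightarrow> a \<in> R)"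

end

text \<open>\<open>convex\<close> and \<open>coconvex\<close> close the set and its complement under
  addition of roots. Each pair has exactly one translate starting in a given window of length
  \<open>n\<close>, so \<open>infinite_window\<close> means infinitely many pairs modulo
  translation.\<close>

locale infinite_biconvex = affine_rank +
  fixes I :: "(int \<times> int) set"
  assumes less: "(a, b) \<in> I \<Longrightarrow> a < b"
    and not_cong: "(a, b) \<in> I \<Longrightarrow> \<not> int n dvd b - a"
    and shift: "(a, b) \<in> I \<Longrightarrow> (a + c * int n, b + c * int n) \<in> I"
    and convex: "(a, b) \<in> I \<Longrightarrow> (b, c) \<in> I \<Longrightarrow> (a, c) \<in> I"
    and coconvex: "(a, c) \<in> I \<Longrightarrow> a < b \<Longrightarrow> b < c \<Longrightarrow> (a, b) \<in> I \<or> (b, c) \<in> I"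
    and infinite_window: "infinite {(a, b). (a, b) \<in> I \<and> l \<le> a \<and> a < l + int n}"
begin

lemma split_pairs_exists:
  obtains R where "shift_closed R" "R \<noteq> {}" "R \<noteq> UNIV" "split_pairs R \<subseteq> I"
proof -
  have n0: "int n > 0" using n2 by simp
  let ?S = "{(a, b). (a, b) \<in> I \<and> 0 \<le> a \<and> a < 0 + int n}"
  have "?S \<subseteq> (\<Union>a\<in>{0..<int n}. \<Union>r\<in>{0..<int n}. Pair a ` {b. (a, b) \<in> I \<and> b mod int n = r})"
  proof clarify
    fix a b assume "(a, b) \<in> I" "0 \<le> a" "a < 0 + int n"
    then show "(a, b) \<in> (\<Union>a\<in>{0..<int n}. \<Union>r\<in>{0..<int n}. Pair a ` {b. (a, b) \<in> I \<and> b mod int n = r})"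
      using n0 by (intro UN_I[of a] UN_I[of "b mod int n"]) auto
  qed
  \<comment> \<open>Pigeonhole over the first entry and the residue of the second.\<close>
  then obtain a0 r where "infinite (Pair a0 ` {b. (a0, b) \<in> I \<and> b mod int n = r})"
    using infinite_window[of 0] finite_subset
    by (metis (no_types, lifting) finite_UN finite_atLeastLessThan_int)
  then have inf: "infinite {b. (a0, b) \<in> I \<and> b mod int n = r}" by blast
  define R where "R = {a. \<forall>c. a < r + c * int n \<longrightarrow> (a, r + c * int n) \<in> I}"
  have "a + d * int n \<in> R" if "a \<in> R" for a d
  proof -
    have "(a + d * int n, r + c * int n) \<in> I" if "a + d * int n < r + c * int n" for c
    proof -
      have "a < r + (c - d) * int n" using that by (simp add: algebra_simps)
      then have "(a, r + (c - d) * int n) \<in> I" using \<open>a \<in> R\<close> unfolding R_def by blast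
      from shift[OF this, of d] show ?thesis by (simp add: algebra_simps)
    qed
    then show ?thesis by (simp add: R_def)
  qed
  then have "shift_closed R"
    unfolding shift_closed_def by (metis add_diff_cancel_right' diff_minus_eq_add minus_mult_left add_uminus_conv_diff)
  \<comment> \<open>Beyond \<open>r + c * int n\<close>, \<open>a0\<close> crosses a further member
    \<open>b\<close> of the class. Members of one class never cross, so coconvexity leaves only the
    crossing of \<open>a0\<close> with \<open>r + c * int n\<close>.\<close>
  moreover have "a0 \<in> R"
  proof -
    have "(a0, r + c * int n) \<in> I" if "a0 < r + c * int n" for c
    proof -
      have "\<not> {b. (a0, b) \<in> I \<and> b mod int n = r} \<subseteq> {a0..r + c * int n}"
        using inf finite_subset by blast
      then obtain b where b: "(a0, b) \<in> I" "b mod int n = r" "r + c * int n < b"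
        using less by force
      then have "(r + c * int n, b) \<notin> I"
        using not_cong[of "r + c * int n" b] by (auto simp: mod_eq_dvd_iff[symmetric])
      then show ?thesis using coconvex[OF b(1) that b(3)] by blast
    qed
    then show ?thesis by (simp add: R_def)
  qed
  moreover have "r \<notin> R"
  proof
    assume "r \<in> R"
    then have "r < r + 1 * int n \<longrightarrow> (r, r + 1 * int n) \<in> I" unfolding R_def by blast
    then have "(r, r + 1 * int n) \<in> I" using n0 by simp
    from not_cong[OF this] show False by simp
  qed
  \<comment> \<open>As \<open>b \<notin> R\<close>, some member of the class right of
    \<open>b\<close> is not crossed by \<open>b\<close>, but it is crossed by \<open>a\<close>;
    apply coconvexity at \<open>b\<close>.\<close>
  moreover have "split_pairs R \<subseteq> I"
  proof -
    have "(a, b) \<in> I" if ab: "a < b" "a \<in> R" "b \<notin> R" for a b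
    proof -
      from ab obtain c where c: "b < r + c * int n" "(b, r + c * int n) \<notin> I" by (auto simp: R_def)
      then have "(a, r + c * int n) \<in> I" using ab by (auto simp: R_def)
      from coconvex[OF this ab(1) c(1)] c show ?thesis by blast
    qed
    then show ?thesis by (auto simp: split_pairs_def)
  qed
  ultimately show ?thesis using that by blast
qed

text \<open>If \<open>(a, b)\<close> is missing, no pair from some \<open>c < a\<close> can end at
  \<open>d > b\<close>: coconvexity at \<open>a\<close>, then at \<open>b\<close>, would need a pair
  ending in \<open>R\<close>, a pair starting outside \<open>R\<close>, or \<open>(a, b)\<close>
  itself.\<close>

lemma eq_split_pairs:
  assumes "I \<subseteq> split_pairs R"
  shows "I = split_pairs R"
proof (rule ccontr)
  assume "I \<noteq> split_pairs R"
  then obtain a b where ab: "a < b" "a \<in> R" "b \<notin> R" "(a, b) \<notin> I"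
    using assms by (auto simp: split_pairs_def)
  have R: "c \<in> R" "d \<notin> R" if "(c, d) \<in> I" for c d
    using assms that by (auto simp: split_pairs_def)
  have "d \<le> b" if cd: "(c, d) \<in> I" "c < a" for c d
  proof (rule ccontr)
    assume d: "\<not> d \<le> b"
    then have "(a, d) \<in> I" using coconvex[OF cd(1), of a] cd ab R(2)[of c a] by auto
    then show False using coconvex[of a d b] ab d R(1)[of b d] by auto
  qed
  \<comment> \<open>So only finitely many pairs are left modulo translations.\<close>
  then have "{(c, d). (c, d) \<in> I \<and> a - int n \<le> c \<and> c < a - int n + int n} \<subseteq> {a - int n..a} \<times> {a - int n..b}"
    using less by force
  then show False using infinite_window[of "a - int n"] finite_subset by blast
qed

text \<open>Any other pair extends to a chain: if \<open>a \<notin> R\<close>, an element of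
  \<open>R\<close> left of \<open>a\<close> crosses \<open>a\<close>; if \<open>b \<in> R\<close>,
  \<open>b\<close> crosses an element outside \<open>R\<close> to its right.\<close>

lemma eq_split_pairs_of_avoiding:
  assumes avoid: "\<And>a b c. (a, b) \<in> I \<Longrightarrow> (b, c) \<notin> I"
    and R: "shift_closed R" "R \<noteq> {}" "R \<noteq> UNIV" "split_pairs R \<subseteq> I"
  shows "I = split_pairs R"
proof -
  have "a \<in> R \<and> b \<notin> R" if ab: "(a, b) \<in> I" for a b
  proof -
    from R obtain p q where "p \<in> R" "q \<notin> R" by auto
    from ex_shift_less ex_shift_greater obtain c d where "p + c * int n < a" "b < q + d * int n" by meson
    moreover have "p + c * int n \<in> R" "q + d * int n \<notin> R"
      using \<open>p \<in> R\<close> \<open>q \<notin> R\<close> R by (auto simp: shift_closed_def)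
    ultimately show ?thesis using avoid R(4) ab unfolding split_pairs_def by blast
  qed
  then show ?thesis using R(4) less by (auto simp: split_pairs_def)
qed

end

context affine_rank
begin

text \<open>At a single time the positions are linearly ordered, which gives both convexity
  conditions; crossings persist, so two of them can be observed at a common time.\<close>

lemma infinite_biconvex_crossings:
  assumes x: "infinite_reduced_word n x"
  shows "infinite_biconvex n (crossings x)"
proof unfold_locales
  show cong: "\<not> int n dvd b - a" if "(a, b) \<in> crossings x" for a b
  proof
    assume "int n dvd b - a"
    then obtain c where c: "b = a + c * int n" by (metis mod_eq_shift mod_eq_dvd_iff)
    with that show False by (auto simp: crossings_def)
  qed
  show shift: "(a + c * int n, b + c * int n) \<in> crossings x" if "(a, b) \<in> crossings x" for a b c
    using that by (auto simp: crossings_def)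
  show "(a, c) \<in> crossings x" if ab: "(a, b) \<in> crossings x" "(b, c) \<in> crossings x" for a b c
  proof -
    from ab obtain k m where "a < b" "b < c"
      and k: "word_pos n (prefix_word x k) b < word_pos n (prefix_word x k) a"
        "word_pos n (prefix_word x m) c < word_pos n (prefix_word x m) b"
      by (auto simp: crossings_def)
    moreover have "word_pos n (prefix_word x (max k m)) b < word_pos n (prefix_word x (max k m)) a"
      "word_pos n (prefix_word x (max k m)) c < word_pos n (prefix_word x (max k m)) b"
      using crossed_mono[OF x, of a b k "max k m"] crossed_mono[OF x, of b c m "max k m"] k
        \<open>a < b\<close> \<open>b < c\<close> by auto
    ultimately show ?thesis unfolding crossings_def
      by (auto intro!: exI[of _ "max k m"] elim: order.strict_trans)
  qed
  show "(a, b) \<in> crossings x \<or> (b, c) \<in> crossings x" if "(a, c) \<in> crossings x" "a < b" "b < c" for a b c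
    using that by (auto simp: crossings_def) (metis linorder_not_less order_le_less_trans not_less_iff_gr_or_eq)
  show "infinite {(a, b). (a, b) \<in> crossings x \<and> l \<le> a \<and> a < l + int n}" for l
  proof
    let ?S = "{(a, b). (a, b) \<in> crossings x \<and> l \<le> a \<and> a < l + int n}"
    assume "finite ?S"
    moreover have "Inv n x \<subseteq> (\<lambda>(a, b). affine_root n a b) ` ?S"
    proof
      fix t assume "t \<in> Inv n x"
      then obtain a b where ab: "(a, b) \<in> crossings x" "t = affine_root n a b" using Inv_eq[OF x] by auto
      define c where "c = - ((a - l) div int n)"
      have "a + c * int n - l = (a - l) mod int n" by (simp add: c_def minus_div_mult_eq_mod[symmetric])
      then have "l \<le> a + c * int n" "a + c * int n < l + int n"
        using n2 pos_mod_sign[of "int n" "a - l"] pos_mod_bound[of "int n" "a - l"] by linarith+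
      then have "(a + c * int n, b + c * int n) \<in> ?S" using shift[OF ab(1)] by simp
      moreover have "t = affine_root n (a + c * int n) (b + c * int n)" using ab by (simp add: affine_root_shift)
      ultimately show "t \<in> (\<lambda>(a, b). affine_root n a b) ` ?S" by force
    qed
    ultimately have "finite (Inv n x)" by (meson finite_imageI finite_subset)
    then show False using infinite_Inv[OF x] by blast
  qed
qed (auto simp: crossings_def)

lemma Inv_subset_iff:
  assumes x: "infinite_reduced_word n x" and y: "infinite_reduced_word n y"
  shows "Inv n x \<subseteq> Inv n y \<longleftrightarrow> crossings x \<subseteq> crossings y"
proof
  assume sub: "Inv n x \<subseteq> Inv n y"
  interpret X: infinite_biconvex n "crossings x" by (rule infinite_biconvex_crossings[OF x])
  interpret Y: infinite_biconvex n "crossings y" by (rule infinite_biconvex_crossings[OF y])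
  show "crossings x \<subseteq> crossings y"
  proof clarify
    fix a b assume ab: "(a, b) \<in> crossings x"
    then have "affine_root n a b \<in> Inv n y" using sub Inv_eq[OF x] by auto
    then obtain c d where cd: "(c, d) \<in> crossings y" "affine_root n a b = affine_root n c d"
      using Inv_eq[OF y] by auto
    then obtain k where "c = a + k * int n" "d = b + k * int n"
      using affine_root_inject X.not_cong[OF ab] by blast
    then show "(a, b) \<in> crossings y" using Y.shift[OF cd(1), of "- k"] by simp
  qed
qed (auto simp: Inv_eq x y)

lemma Inv_eq_iff:
  "infinite_reduced_word n x \<Longrightarrow> infinite_reduced_word n y \<Longrightarrow> Inv n x = Inv n y \<longleftrightarrow> crossings x = crossings y"
  using Inv_subset_iff[of x y] Inv_subset_iff[of y x] by auto

end

context affine_rank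
begin

section \<open>Coxeter words\<close>

text \<open>Every step takes a member of \<open>R\<close> rightwards past a nonmember, so a
  nonmember left of a member stays left of it. Hence swapped pairs are in their original
  order.\<close>

lemma reduced_of_split_steps:
  assumes x: "\<And>k. x k < n"
    and step: "\<And>k p. p mod int n = int (x k) mod int n \<Longrightarrow>
      word_prod n (prefix_word x k) p \<in> R \<and> word_prod n (prefix_word x k) (p + 1) \<notin> R"
  shows "infinite_reduced_word n x" "crossings x \<subseteq> split_pairs R"
proof -
  have stay: "word_pos n (prefix_word x k) b < word_pos n (prefix_word x k) a"
    if "b < a" "a \<in> R" "b \<notin> R" for k a b
  proof (induction k)
    case 0
    then show ?case using that by simp
  next
    case (Suc k)
    show ?case
    proof (rule ccontr)
      assume "\<not> ?thesis"
      then have "word_pos n (prefix_word x k) b mod int n = int (x k) mod int n"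
        using crossing_step(2)[OF Suc] by simp
      from step[OF this] show False using that by simp
    qed
  qed
  show "infinite_reduced_word n x"
  proof (rule infinite_reducedI[OF x])
    fix k
    let ?w = "word_prod n (prefix_word x k)"
    show "?w (int (x k)) < ?w (int (x k) + 1)"
    proof (rule ccontr)
      assume "\<not> ?thesis"
      then have "?w (int (x k) + 1) < ?w (int (x k))"
        using word_prod_inject[of "prefix_word x k" "int (x k)" "int (x k) + 1"] by (simp add: not_less less_le)
      from stay[OF this, of k] step[of "int (x k)" k] show False by simp
    qed
  qed
  show "crossings x \<subseteq> split_pairs R"
  proof clarify
    fix a b assume "(a, b) \<in> crossings x"
    then obtain k where ab: "a < b" "word_pos n (prefix_word x k) b < word_pos n (prefix_word x k) a"
      by (auto simp: crossings_def)
    from crossing_exists[OF this] obtain m where m: "m < k"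
      "word_pos n (prefix_word x m) b = word_pos n (prefix_word x m) a + 1"
      "word_pos n (prefix_word x m) a mod int n = int (x m) mod int n"
      by (auto simp: take_prefix_word) (metis prefix_word_def nth_map_upt diff_zero add_0 take_prefix_word less_imp_le)
    have "a \<in> R" "word_prod n (prefix_word x m) (word_pos n (prefix_word x m) b) \<notin> R"
      using step[OF m(3)] unfolding m(2) by simp_all
    then have "a \<in> R" "b \<notin> R" by simp_all
    then show "(a, b) \<in> split_pairs R" using ab by (simp add: split_pairs_def)
  qed
qed

end

section \<open>The process driven by the infinite power of a Coxeter word\<close>

locale coxeter_letters = affine_rank +
  fixes u :: "nat list"
  assumes distinct: "distinct u" and letters: "set u = {..<n}"
begin

definition index :: "int \<Rightarrow> int" where
  "index p = int (the_inv_into {..<n} ((!) u) (nat (p mod int n)))"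

lemma length_u [simp]: "length u = n"
  using distinct_card[OF distinct] letters by simp

lemma inj_u: "inj_on ((!) u) {..<n}"
  using distinct by (auto intro: inj_on_nth)

lemma index_bounds: "0 \<le> index p" "index p < int n"
  and nth_index: "u ! nat (index p) = nat (p mod int n)"
proof -
  have "nat (p mod int n) \<in> (!) u ` {..<n}"
    using n2 letters by (auto simp: set_conv_nth image_def nat_less_iff)
  then show "0 \<le> index p" "index p < int n" "u ! nat (index p) = nat (p mod int n)"
    using the_inv_into_into[OF inj_u, of "nat (p mod int n)" "{..<n}"] f_the_inv_into_f[OF inj_u]
    by (auto simp: index_def)
qed

lemma index_nth: "k < n \<Longrightarrow> p mod int n = int (u ! k) \<longleftrightarrow> index p = int k"
proof
  assume k: "k < n"
  { assume "p mod int n = int (u ! k)"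
    then show "index p = int k" using the_inv_into_f_f[OF inj_u, of k] k by (simp add: index_def) }
  assume "index p = int k"
  then show "p mod int n = int (u ! k)" using nth_index[of p] n2 by simp
qed

text \<open>The number of steps from time \<open>k\<close> until the letter \<open>p\<close> is used next. The particle in position \<open>p\<close>
  moves right next iff the letter \<open>p\<close> comes up before \<open>p - 1\<close>.\<close>

definition wait :: "nat \<Rightarrow> int \<Rightarrow> int" where
  "wait k p = (index p - int k) mod int n"

lemma wait_bounds: "0 \<le> wait k p" "wait k p < int n"
  using n2 by (simp_all add: wait_def)

lemma repeat_word_less: "repeat_word u k < n"
  using letters n2 by (metis length_u lessThan_iff mod_less_divisor nth_mem repeat_word_def zero_less_numeral less_le_trans)

lemma wait_eq_0_iff: "wait k p = 0 \<longleftrightarrow> p mod int n = int (repeat_word u k) mod int n"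
proof -
  have "wait k p = 0 \<longleftrightarrow> index p mod int n = int k mod int n"
    by (simp add: wait_def mod_eq_dvd_iff dvd_eq_mod_eq_0)
  also have "\<dots> \<longleftrightarrow> index p = int (k mod n)"
    using index_bounds[of p] by (simp add: zmod_int)
  also have "\<dots> \<longleftrightarrow> p mod int n = int (u ! (k mod n))"
    using index_nth[of "k mod n" p] n2 by simp
  also have "int (u ! (k mod n)) = int (repeat_word u k) mod int n"
    using repeat_word_less[of k] by (simp add: repeat_word_def)
  finally show ?thesis .
qed

lemma wait_Suc: "wait (Suc k) p = (if wait k p = 0 then int n - 1 else wait k p - 1)"
proof -
  have "wait (Suc k) p = (wait k p - 1) mod int n"
    by (simp add: wait_def mod_diff_left_eq algebra_simps)
  moreover have "(- 1) mod int n = int n - 1" using n2 by (simp add: zmod_minus1)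
  moreover have "(wait k p - 1) mod int n = wait k p - 1" if "wait k p \<noteq> 0"
    using wait_bounds[of k p] that by simp
  ultimately show ?thesis by auto
qed

definition right_movers :: "int set" where
  "right_movers = {p. index p < index (p - 1)}"

text \<open>Directions never change: after a right move into \<open>p\<close> the letter
  \<open>p - 1\<close> was just used and is due last; after a left move into \<open>p\<close> this
  holds for the letter \<open>p\<close>. Otherwise both waiting times drop by one.\<close>

lemma right_movers_iff:
  "word_prod n (prefix_word (repeat_word u) k) p \<in> right_movers \<longleftrightarrow> wait k p < wait k (p - 1)"
proof (induction k arbitrary: p)
  case 0
  then show ?case using index_bounds by (simp add: right_movers_def wait_def)
next
  case (Suc k)
  let ?i = "repeat_word u k"
  have IH: "word_prod n (prefix_word (repeat_word u) (Suc k)) p \<in> right_movers \<longleftrightarrow>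
      wait k (simple_gen n ?i p) < wait k (simple_gen n ?i p - 1)"
    using Suc by simp
  consider (1) "p mod int n = int ?i mod int n" | (2) "(p - 1) mod int n = int ?i mod int n"
    | (3) "p mod int n \<noteq> int ?i mod int n" "(p - 1) mod int n \<noteq> int ?i mod int n" by blast
  then show ?case
  proof cases
    case 1
    then have "wait k p = 0" "simple_gen n ?i p = p + 1"
      by (simp_all add: wait_eq_0_iff simple_gen_here)
    then show ?thesis using IH wait_bounds[of k "p + 1"] wait_bounds[of "Suc k" "p - 1"]
      by (simp add: wait_Suc[of k p])
  next
    case 2
    then have "wait k (p - 1) = 0" "simple_gen n ?i p = p - 1"
      using simple_gen_next[OF 2] by (simp_all add: wait_eq_0_iff)
    moreover have "wait k (p - 1 - 1) \<noteq> 0" "wait k p \<noteq> 0"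
      using 2 not_cong_next[of "p - 1 - 1" "int ?i"] not_cong_next[of "p - 1" "int ?i"] by (auto simp: wait_eq_0_iff)
    ultimately show ?thesis
      using IH wait_bounds[of k "p - 1 - 1"] wait_bounds[of k p] by (simp add: wait_Suc)
  next
    case 3
    then have "wait k p \<noteq> 0" "wait k (p - 1) \<noteq> 0" "simple_gen n ?i p = p"
      by (simp_all add: wait_eq_0_iff simple_gen_alt)
    then show ?thesis using IH by (simp add: wait_Suc)
  qed
qed

lemma repeat_word_split_step:
  assumes "p mod int n = int (repeat_word u k) mod int n"
  shows "word_prod n (prefix_word (repeat_word u) k) p \<in> right_movers \<and>
    word_prod n (prefix_word (repeat_word u) k) (p + 1) \<notin> right_movers"
proof -
  have "wait k p = 0" using assms by (simp add: wait_eq_0_iff)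
  moreover have "wait k (p - 1) \<noteq> 0"
    using assms not_cong_next[of "p - 1" "int (repeat_word u k)"] by (auto simp: wait_eq_0_iff)
  ultimately show ?thesis
    using wait_bounds[of k "p - 1"] wait_bounds[of k "p + 1"] by (simp_all add: right_movers_iff)
qed

lemma infinite_reduced_repeat_word: "infinite_reduced_word n (repeat_word u)"
  by (rule reduced_of_split_steps(1)[OF repeat_word_less repeat_word_split_step])

text \<open>The steps give one inclusion; equality is the rigidity of infinite biconvex
  sets.\<close>

lemma crossings_repeat_word: "crossings (repeat_word u) = split_pairs right_movers"
proof -
  interpret infinite_biconvex n "crossings (repeat_word u)"
    by (rule infinite_biconvex_crossings[OF infinite_reduced_repeat_word])
  show ?thesis
    by (rule eq_split_pairs[OF reduced_of_split_steps(2)[OF repeat_word_less repeat_word_split_step]])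
qed

lemma prefix_repeat_word: "prefix_word (repeat_word u) n = u"
  by (rule nth_equalityI) (simp_all add: prefix_word_def repeat_word_def)

end

context affine_rank
begin

text \<open>\<open>u\<close> has to list \<open>p\<close> before \<open>p - 1\<close> exactly for
  \<open>p \<in> R\<close>. It is obtained by sorting the residues by a potential that decreases
  from \<open>p - 1\<close> to \<open>p\<close> exactly in this case; neighbours never tie.\<close>

lemma coxeter_word_exists:
  assumes sc: "shift_closed R" and ne: "R \<noteq> {}" "R \<noteq> UNIV"
  obtains u where "coxeter_letters n u" "coxeter_letters.right_movers n u = R"
proof -
  have n0: "int n > 0" using n2 by simp
  define A where "A = {j. j < n \<and> int j \<in> R}"
  define B where "B = {j. j < n \<and> int j \<notin> R}"
  \<comment> \<open>The increments \<open>g\<close> of the potential \<open>h\<close> sum to zero around the circle, so \<open>h p < h (p - 1)\<close> iff \<open>p \<in> R\<close>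
    also across the cut between \<open>n - 1\<close> and \<open>0\<close>.\<close>
  define g where "g j = (if int j \<in> R then - int (card B) else int (card A))" for j
  define h where "h p = (\<Sum>j = 1..p. g j)" for p
  define u where "u = sort_key h [0..<n]"
  have fin: "finite A" "finite B" by (simp_all add: A_def B_def)
  have red: "int (nat (p mod int n)) \<in> R \<longleftrightarrow> p \<in> R" for p
  proof -
    have "p mod int n + (p div int n) * int n \<in> R \<longleftrightarrow> p mod int n \<in> R"
      using sc by (simp only: shift_closed_def)
    then show ?thesis using n0 by simp
  qed
  have lt: "nat (p mod int n) < n" for p using n0 by (simp add: nat_less_iff)
  have "A \<noteq> {}" "B \<noteq> {}" using ne red lt unfolding A_def B_def by blast+
  then have pos: "card A > 0" "card B > 0" using fin by (simp_all add: card_gt_0_iff)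
  have "{..<n} = A \<union> B" "A \<inter> B = {}" by (auto simp: A_def B_def)
  then have "(\<Sum>j<n. g j) = sum g A + sum g B" using fin by (simp add: sum.union_disjoint)
  also have "sum g A = - int (card A) * int (card B)" by (simp add: g_def A_def)
  also have "sum g B = int (card A) * int (card B)" by (simp add: g_def B_def)
  finally have g0: "(\<Sum>j<n. g j) = 0" by simp
  \<comment> \<open>\<open>h 0 = 0\<close> omits the increment \<open>g 0\<close>; as all increments
    sum to zero, the step from \<open>n - 1\<close> back to \<open>0\<close> contributes exactly
    \<open>g 0\<close>.\<close>
  have "{..<n} = insert 0 {1..n - 1}" using n2 by auto
  then have hn: "h (n - 1) = - g 0" using g0 by (simp add: h_def)
  have hs: "h i = h (i - 1) + g i" if "i > 0" for i
    using that by (cases i) (simp_all add: h_def)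
  interpret coxeter_letters n u by unfold_locales (simp_all add: u_def atLeast0LessThan)
  have "sorted (map h u)" by (simp add: u_def)
  have lt_index: "index p < index q" if "h (nat (p mod int n)) < h (nat (q mod int n))" for p q
  proof (rule ccontr)
    assume "\<not> ?thesis"
    then have "map h u ! nat (index q) \<le> map h u ! nat (index p)"
      using index_bounds by (intro sorted_nth_mono[OF \<open>sorted (map h u)\<close>]) (auto simp: nat_less_iff)
    then show False using that index_bounds nth_index by (simp add: nat_less_iff)
  qed
  have hd: "h (nat (p mod int n)) - h (nat ((p - 1) mod int n)) = g (nat (p mod int n))" for p
  proof (cases "p mod int n = 0")
    case True
    then have "(p - 1) mod int n = int n - 1"
      by (metis diff_0 mod_diff_left_eq n0 zmod_minus1)
    then have *: "nat ((p - 1) mod int n) = n - 1" by simp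
    have "h 0 = 0" by (simp add: h_def)
    then show ?thesis unfolding * True hn by simp
  next
    case False
    then have 0: "p mod int n > 0" using n0 pos_mod_sign[of "int n" p] by linarith
    then have "(p - 1) mod int n = p mod int n - 1"
      using mod_pos_pos_trivial[of "p mod int n - 1" "int n"] order.strict_trans[OF _ pos_mod_bound[OF n0, of p], of "p mod int n - 1"]
      by (simp add: mod_diff_left_eq)
    then have *: "nat ((p - 1) mod int n) = nat (p mod int n) - 1" by simp
    show ?thesis unfolding * using hs[of "nat (p mod int n)"] 0 by simp
  qed
  have "p \<in> right_movers \<longleftrightarrow> p \<in> R" for p
  proof
    show "p \<in> right_movers" if "p \<in> R"
      unfolding right_movers_def using lt_index[of p "p - 1"] hd[of p] red[of p] that pos by (simp add: g_def)
    show "p \<in> R" if "p \<in> right_movers"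
      using lt_index[of "p - 1" p] hd[of p] red[of p] that pos by (auto simp: g_def right_movers_def)
  qed
  then have "right_movers = R" by blast
  with that coxeter_letters_axioms show ?thesis by blast
qed

section \<open>Products of generators lie in the affine symmetric group\<close>

lemma simple_gen_in_group:
  assumes w: "w \<in> affine_symmetric_group n" and i: "i < n"
  shows "w \<circ> simple_gen n i \<in> affine_symmetric_group n"
proof -
  have per: "w (k + int n) = w k + int n" for k using w by (simp add: affine_symmetric_group_def)
  have "bij (simple_gen n i)" by (rule involuntory_imp_bij) simp
  then have "bij (w \<circ> simple_gen n i)" using w by (auto simp: affine_symmetric_group_def intro: bij_comp)
  moreover have "(w \<circ> simple_gen n i) (k + int n) = (w \<circ> simple_gen n i) k + int n" for k
    using simple_gen_shift[of i k 1] per by simp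
  moreover have "(\<Sum>k = 1..int n. (w \<circ> simple_gen n i) k) = (\<Sum>k = 1..int n. w k)"
  proof (cases "i = 0")
    case True
    \<comment> \<open>The generator 0 moves the ends of the window out to \<open>0\<close> and
      \<open>n + 1\<close>; by periodicity \<open>w 0 + w (n + 1) = w n + w 1\<close>. The other
      generators permute the window.\<close>
    have s: "simple_gen n 0 1 = 0" "simple_gen n 0 (int n) = int n + 1"
      using simple_gen_next[of 0 0] simple_gen_here[of "int n" 0] by simp_all
    have e: "{1..int n} = insert 1 (insert (int n) {2..int n - 1})" using n2 by auto
    have "simple_gen n 0 k = k" if "k \<in> {2..int n - 1}" for k
      using that by (simp add: simple_gen_alt)
    then have "(\<Sum>k = 2..int n - 1. w (simple_gen n 0 k)) = (\<Sum>k = 2..int n - 1. w k)" by simp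
    moreover have "w (int n + 1) = w 1 + int n" "w (int n) = w 0 + int n"
      using per[of 1] per[of 0] by (simp_all add: add.commute)
    ultimately show ?thesis using n2 by (simp add: e True s)
  next
    case False
    have "simple_gen n i k \<in> {1..int n}" if "k \<in> {1..int n}" for k
    proof -
      have "k = int n \<or> k mod int n = k"
        using that mod_pos_pos_trivial[of k "int n"] by (cases "k = int n") auto
      moreover have "(k - 1) mod int n = k - 1" using that by simp
      ultimately show ?thesis using that False i by (auto simp: simple_gen_alt)
    qed
    then have "(\<Sum>k = 1..int n. w (simple_gen n i k)) = (\<Sum>k = 1..int n. w k)"
      by (intro sum.reindex_bij_witness[of _ "simple_gen n i" "simple_gen n i"]) auto
    then show ?thesis by simp
  qed
  ultimately show ?thesis using w by (simp add: affine_symmetric_group_def)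
qed

lemma word_prod_in_group: "is_word n u \<Longrightarrow> word_prod n u \<in> affine_symmetric_group n"
proof (induction u rule: rev_induct)
  case Nil
  have "bij (\<lambda>a :: int. a)" using bij_id by (simp add: id_def)
  then show ?case by (simp add: affine_symmetric_group_def)
next
  case (snoc i u)
  then show ?case using simple_gen_in_group[of "word_prod n u" i] by (simp add: comp_def)
qed

section \<open>Braid moves\<close>

text \<open>For \<open>n \<ge> 3\<close> the classes of \<open>p\<close>, \<open>p + 1\<close>,
  \<open>p + 2\<close> are distinct, so each generator fixes the position that it does not
  swap.\<close>

lemma braid_gens:
  assumes n3: "n \<ge> 3" and p: "p mod int n = int i mod int n"
  defines "j \<equiv> (i + 1) mod n"
  shows "simple_gen n i p = p + 1" "simple_gen n i (p + 1) = p" "simple_gen n i (p + 2) = p + 2"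
    "simple_gen n j p = p" "simple_gen n j (p + 1) = p + 2" "simple_gen n j (p + 2) = p + 1"
    "(p + 1) mod int n = int j mod int n"
proof -
  have j: "(p + 1) mod int n = int j mod int n"
    using p cong_next[of p "int i"] by (simp add: j_def zmod_int add.commute)
  have "(q + d) mod int n \<noteq> q mod int n" if "d = 1 \<or> d = 2" for q d
    using that n3 zdvd_not_zless[of d "int n"] by (auto simp: mod_eq_dvd_iff)
  note ne = this[of 1] this[of 2]
  show "simple_gen n i p = p + 1" "simple_gen n i (p + 1) = p"
    using simple_gen_here[OF p] simple_gen_next[OF p] by simp_all
  show "simple_gen n j (p + 1) = p + 2" "simple_gen n j (p + 2) = p + 1"
    using simple_gen_here[OF j] simple_gen_next[OF j] by (simp_all add: add.assoc)
  show "simple_gen n i (p + 2) = p + 2"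
    using ne(1)[of p] ne(2)[of p] p by (simp add: simple_gen_alt add.commute)
  show "simple_gen n j p = p"
  proof -
    have "(p + 1) mod int n \<noteq> (p - 1) mod int n" using ne(2)[of "p - 1"] by (simp add: add.commute)
    then show ?thesis using ne(1)[of p] j by (auto simp: simple_gen_alt)
  qed
  show "(p + 1) mod int n = int j mod int n" by (rule j)
qed

lemma word_prod_braid:
  assumes n3: "n \<ge> 3" and p: "p mod int n = int i mod int n"
  defines "j \<equiv> (i + 1) mod n"
  shows "word_prod n (u @ [i]) p = word_prod n u (p + 1)"
    "word_prod n (u @ [i]) (p + 1) = word_prod n u p"
    "word_prod n (u @ [i]) (p + 2) = word_prod n u (p + 2)"
    "word_prod n (u @ [j]) p = word_prod n u p"
    "word_prod n (u @ [j]) (p + 1) = word_prod n u (p + 2)"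
    "word_prod n (u @ [j]) (p + 2) = word_prod n u (p + 1)"
  using braid_gens[OF n3 p] by (simp_all add: j_def)

definition has_braid_factor :: "nat list \<Rightarrow> bool" where
  "has_braid_factor u \<longleftrightarrow> n \<ge> 3 \<and> (\<exists>A B i. u = A @ [i, (i + 1) mod n, i] @ B)"

text \<open>The letters \<open>i\<close>, \<open>j\<close>, \<open>i\<close> sort the three
  particles. Appended to a reduced word \<open>A\<close> of the sorted permutation they restore
  \<open>v\<close>, and each of them is an ascent.\<close>

lemma braid_factor_exists_adjacent:
  assumes v: "is_word n v"
    and w: "word_prod n v (p + 2) < word_prod n v (p + 1)" "word_prod n v (p + 1) < word_prod n v p"
  shows "\<exists>u. is_word n u \<and> word_prod n u = word_prod n v \<and> ascending u \<and> has_braid_factor u"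
proof -
  \<comment> \<open>For \<open>n = 2\<close>, position \<open>p + 2\<close> holds a translate of the
    particle in \<open>p\<close>, with a larger label.\<close>
  have n3: "n \<ge> 3"
  proof (rule ccontr)
    assume "\<not> ?thesis"
    then have "n = 2" using n2 by simp
    then have "word_prod n v (p + 2) = word_prod n v p + 2" using word_prod_shift[of v p 1] by simp
    then show False using w by simp
  qed
  define i where "i = nat (p mod int n)"
  define j where "j = (i + 1) mod n"
  have n0: "int n > 0" using n2 by simp
  have p: "p mod int n = int i mod int n" and ij: "i < n" "j < n"
    using n0 by (simp_all add: i_def j_def nat_less_iff)
  note br = word_prod_braid[OF n3 p, folded j_def]
  have "is_word n (((v @ [i]) @ [j]) @ [i])" using v ij by simp
  then obtain A where "reduced_word n (word_prod n (((v @ [i]) @ [j]) @ [i])) A"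
    using reduced_word_exists by blast
  then have A: "is_word n A" "word_prod n A = word_prod n (((v @ [i]) @ [j]) @ [i])" "ascending A"
    using reduced_imp_ascending by (auto simp: reduced_word_def)
  let ?u = "((A @ [i]) @ [j]) @ [i]"
  have wA: "word_prod n A p = word_prod n v (p + 2)" "word_prod n A (p + 1) = word_prod n v (p + 1)"
    "word_prod n A (p + 2) = word_prod n v p"
    unfolding A(2) by (simp_all only: br)
  have "word_prod n ?u = word_prod n v"
    using A(2) by (simp add: fun_eq_iff)
  moreover have "ascending ?u"
  proof -
    have "word_prod n A p < word_prod n A (p + 1)" using wA w by simp
    moreover have "word_prod n (A @ [i]) (p + 1) < word_prod n (A @ [i]) (p + 1 + 1)"
      using br(2)[of A] br(3)[of A] wA w by (simp add: add.assoc)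
    moreover have "word_prod n ((A @ [i]) @ [j]) p < word_prod n ((A @ [i]) @ [j]) (p + 1)"
      unfolding br wA using w by simp
    ultimately show ?thesis
      unfolding ascending_snoc using A(3) ascent_cong[OF p] ascent_cong[OF braid_gens(7)[OF n3 p, folded j_def]]
      by blast
  qed
  moreover have "has_braid_factor ?u"
    unfolding has_braid_factor_def using n3 by (intro conjI exI[of _ A] exI[of _ i] exI[of _ "[]"]) (auto simp: j_def)
  ultimately show ?thesis using A ij by (intro exI[of _ ?u]) auto
qed

text \<open>\<open>i\<close> is a descent of \<open>v\<close>, hence an ascent after
  \<open>v @ [i]\<close>, so a word for the latter may be prolonged by \<open>i\<close>.\<close>

lemma braid_factor_snoc:
  assumes "is_word n u" "word_prod n u = word_prod n (v @ [i])" "ascending u" "has_braid_factor u"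
    and i: "i < n" and p: "p mod int n = int i mod int n" and des: "word_prod n v (p + 1) < word_prod n v p"
  shows "\<exists>u. is_word n u \<and> word_prod n u = word_prod n v \<and> ascending u \<and> has_braid_factor u"
proof (intro exI[of _ "u @ [i]"] conjI)
  show "word_prod n (u @ [i]) = word_prod n v" using assms(2) by (simp add: fun_eq_iff)
  have "word_prod n u p < word_prod n u (p + 1)"
    unfolding assms(2) using des simple_gen_here[OF p] simple_gen_next[OF p] by simp
  then show "ascending (u @ [i])" using assms(3) ascent_cong[OF p] by simp
  show "has_braid_factor (u @ [i])"
    using assms(4) unfolding has_braid_factor_def by (metis append_assoc)
qed (use assms in auto)

text \<open>Move \<open>p\<close> or \<open>r\<close> inwards, undoing a swap if the neighbouring particle is in the way, until the
  three positions are adjacent.\<close>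

lemma braid_factor_exists:
  assumes "is_word n v" "p < q" "q < r"
    and "word_prod n v r < word_prod n v q" "word_prod n v q < word_prod n v p"
  shows "\<exists>u. is_word n u \<and> word_prod n u = word_prod n v \<and> ascending u \<and> has_braid_factor u"
  using assms
proof (induction "nat (r - p)" arbitrary: v p q r rule: less_induct)
  case less
  note w = less.prems
  have n0: "int n > 0" using n2 by simp
  \<comment> \<open>Congruent positions hold translates of one particle, which never change
    order.\<close>
  have incong: "s mod int n \<noteq> t mod int n" if st: "s < t" "word_prod n v t < word_prod n v s" for s t
  proof
    assume "s mod int n = t mod int n"
    then obtain c where "t = s + c * int n" using mod_eq_shift by metis
    with st show False by simp
  qed
  have pq: "p mod int n \<noteq> q mod int n" and qr: "q mod int n \<noteq> r mod int n" and pr: "p mod int n \<noteq> r mod int n"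
    using incong w by auto
  have gen: "\<exists>i<n. s mod int n = int i mod int n" for s
    using n0 by (intro exI[of _ "nat (s mod int n)"]) (simp add: nat_less_iff)
  consider (1) "p + 1 < q" "word_prod n v p < word_prod n v (p + 1)"
    | (2) "p + 1 < q" "word_prod n v (p + 1) < word_prod n v p"
    | (3) "q < r - 1" "word_prod n v (r - 1) < word_prod n v r"
    | (4) "q < r - 1" "word_prod n v r < word_prod n v (r - 1)"
    | (5) "q = p + 1" "r = p + 2"
    using word_prod_inject[of v p "p + 1"] word_prod_inject[of v r "r - 1"] w by linarith
  then show ?case
  proof cases
    case 1
    \<comment> \<open>The particle in \<open>p + 1\<close> has an even larger label and replaces the
      one in \<open>p\<close>.\<close>
    then show ?thesis using less.hyps[of r "p + 1" v q] w by simp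
  next
    case 2
    obtain i where i: "i < n" "p mod int n = int i mod int n" using gen by blast
    have "simple_gen n i (p + 1) = p" "simple_gen n i p = p + 1"
      using simple_gen_next[OF i(2)] simple_gen_here[OF i(2)] by simp_all
    \<comment> \<open>Translates of the swap may also move \<open>q\<close> and \<open>r\<close>;
      since neither is congruent to \<open>p\<close>, their order is kept and \<open>r\<close> does
      not move right, so the range shrinks.\<close>
    moreover have "p + 1 < simple_gen n i q"
      using simple_gen_less[of p q i] 2 \<open>simple_gen n i p = p + 1\<close> by auto
    moreover have "simple_gen n i q < simple_gen n i r"
      using simple_gen_less[of q r i] w pq i by auto
    moreover have "simple_gen n i r \<le> r" using pr i by (simp add: simple_gen_alt)
    ultimately have "\<exists>u. is_word n u \<and> word_prod n u = word_prod n (v @ [i]) \<and> ascending u \<and> has_braid_factor u"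
      using less.hyps[of "simple_gen n i r" "p + 1" "v @ [i]" "simple_gen n i q"] w i by simp
    then show ?thesis using braid_factor_snoc i 2(2) by blast
  next
    case 3
    then show ?thesis using less.hyps[of "r - 1" p v q] w by simp
  next
    case 4
    obtain i where i: "i < n" "(r - 1) mod int n = int i mod int n" using gen by blast
    have r: "simple_gen n i (r - 1) = r" "simple_gen n i r = r - 1"
      using simple_gen_next[OF i(2)] simple_gen_here[OF i(2)] by simp_all
    moreover have "simple_gen n i q < r - 1"
      using simple_gen_less[of q r i] 4 r by auto
    moreover have "simple_gen n i p < simple_gen n i q"
      using simple_gen_less[of p q i] w i qr cong_next[of p "r - 1"] by auto
    moreover have "p \<le> simple_gen n i p"
      using i pr cong_next[of "p - 1" "r - 1"] by (auto simp: simple_gen_alt)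
    ultimately have "\<exists>u. is_word n u \<and> word_prod n u = word_prod n (v @ [i]) \<and> ascending u \<and> has_braid_factor u"
      using less.hyps[of "r - 1" "simple_gen n i p" "v @ [i]" "simple_gen n i q"] w i by simp
    then show ?thesis using braid_factor_snoc[of _ v i "r - 1"] i 4(2) by auto
  next
    case 5
    show ?thesis using braid_factor_exists_adjacent[of v p] w unfolding 5 by simp
  qed
qed

text \<open>Prefixes of length at least \<open>k\<close> keep their product, and as crossings
  persist these prefixes determine the crossing set.\<close>

lemma replace_prefix:
  assumes x: "infinite_reduced_word n x"
    and v: "is_word n v" "word_prod n v = word_prod n (prefix_word x k)" "ascending v" "length v = k"
  defines "y \<equiv> \<lambda>m. if m < k then v ! m else x m"
  shows "infinite_reduced_word n y" "crossings y = crossings x"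
proof -
  have small: "prefix_word y m = take m v" if "m \<le> k" for m
    using that v by (intro nth_equalityI) (auto simp: prefix_word_def y_def)
  have large: "word_prod n (prefix_word y m) = word_prod n (prefix_word x m)" if "k \<le> m" for m
    using that
  proof (induction m rule: dec_induct)
    case base
    then show ?case using small[of k] v by simp
  next
    case (step m)
    then show ?case by (simp add: y_def)
  qed
  show y: "infinite_reduced_word n y"
  proof (rule infinite_reducedI)
    fix m
    show "y m < n"
      using infinite_reducedD(1)[OF x, of m] v(1,4) nth_mem[of m v, THEN subsetD[of "set v" "{..<n}", rotated]] unfolding y_def is_word_def
      by (cases "m < k") auto
    show "word_prod n (prefix_word y m) (int (y m)) < word_prod n (prefix_word y m) (int (y m) + 1)"
    proof (cases "m < k")
      case True
      then show ?thesis using v small[of m] by (simp add: ascending_def y_def)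
    next
      case False
      then show ?thesis using large[of m] infinite_reducedD(4)[OF x, of m] by (simp add: y_def)
    qed
  qed
  have *: "crossings z = {(a, b). a < b \<and> (\<exists>m\<ge>k. word_pos n (prefix_word z m) b < word_pos n (prefix_word z m) a)}"
    if z: "infinite_reduced_word n z" for z
  proof -
    have "\<exists>m\<ge>k. word_pos n (prefix_word z m) b < word_pos n (prefix_word z m) a"
      if "a < b" "word_pos n (prefix_word z l) b < word_pos n (prefix_word z l) a" for a b l
      using crossed_mono[OF z that(1) _ that(2), of "max k l"] by (intro exI[of _ "max k l"]) simp
    then show ?thesis unfolding crossings_def by blast
  qed
  show "crossings y = crossings x"
    unfolding *[OF x] *[OF y] using word_pos_cong[OF large] by auto
qed

section \<open>Full commutativity and the limit weak order in terms of crossings\<close>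

lemma braid_class_eq:
  assumes "infinite_reduced_word n x"
  shows "braid_class n x = {y. infinite_reduced_word n y \<and> crossings y = crossings x}"
proof -
  have "braid_class n x = {y. infinite_reduced_word n y \<and> Inv n x = Inv n y}"
    using assms by (auto simp: braid_class_def braid_equiv_def)
  also have "\<dots> = {y. infinite_reduced_word n y \<and> crossings y = crossings x}"
    using Inv_eq_iff[OF assms] by (intro Collect_cong) auto
  finally show ?thesis .
qed

text \<open>At a common time \<open>a\<close>, \<open>b\<close>, \<open>c\<close> stand in reverse
  order, so that prefix has a reduced word with a braid factor. Substituting it stays within the
  class.\<close>

lemma fully_commutative_avoids:
  assumes x: "infinite_reduced_word n x" and fc: "fully_commutative n (braid_class n x)"
    and ab: "(a, b) \<in> crossings x" and bc: "(b, c) \<in> crossings x"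
  shows False
proof -
  obtain k m where "a < b" "b < c"
    and "word_pos n (prefix_word x k) b < word_pos n (prefix_word x k) a"
      "word_pos n (prefix_word x m) c < word_pos n (prefix_word x m) b"
    using ab bc by (auto simp: crossings_def)
  moreover define l where "l = max k m"
  ultimately have l: "word_pos n (prefix_word x l) c < word_pos n (prefix_word x l) b"
      "word_pos n (prefix_word x l) b < word_pos n (prefix_word x l) a"
    using crossed_mono[OF x, of a b k l] crossed_mono[OF x, of b c m l] by auto
  have pre: "is_word n (prefix_word x l)" by (rule infinite_reducedD[OF x])
  obtain v where v: "is_word n v" "word_prod n v = word_prod n (prefix_word x l)" "ascending v" "has_braid_factor v"
    using braid_factor_exists[OF pre l] \<open>a < b\<close> \<open>b < c\<close> by auto
  \<comment> \<open>Both words are reduced for the same element, so the tail of \<open>x\<close>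
    keeps its place.\<close>
  have len: "length v = l"
    using v reduced_iff_ascending[OF v(1)] reduced_iff_ascending[OF pre] infinite_reducedD(3)[OF x, of l]
    by (simp add: reduced_word_def)
  define y where "y = (\<lambda>m. if m < l then v ! m else x m)"
  have "y \<in> braid_class n x"
    using replace_prefix[OF x v(1-3) len] by (simp add: braid_class_eq[OF x] y_def)
  moreover obtain A B i where n3: "n \<ge> 3" and AB: "v = A @ [i, (i + 1) mod n, i] @ B"
    using v(4) by (auto simp: has_braid_factor_def)
  have "i < n" using v(1) AB by simp
  have "y (length A) = i" "y (length A + 1) = (i + 1) mod n" "y (length A + 2) = i"
    using len by (auto simp: y_def AB nth_append)
  then have "braid_move n y (y(length A := (i + 1) mod n, length A + 1 := i, length A + 2 := (i + 1) mod n))"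
    unfolding braid_move_def using n3 \<open>i < n\<close>
    by (intro conjI exI[of _ "length A"] exI[of _ i] exI[of _ "(i + 1) mod n"]) auto
  ultimately show False using fc by (auto simp: fully_commutative_def)
qed

text \<open>The factor reverses three adjacent particles; its first and last letters swap the two
  pairs that contain the middle one, in an order depending on the orientation.\<close>

lemma braid_move_crossings:
  assumes y: "infinite_reduced_word n y" and move: "braid_move n y z"
  shows "\<exists>a b c. (a, b) \<in> crossings y \<and> (b, c) \<in> crossings y"
proof -
  from move obtain k a b where n3: "n \<ge> 3" and ab: "a < n" "b < n" "b = (a + 1) mod n \<or> a = (b + 1) mod n"
    and y3: "y k = a" "y (Suc k) = b" "y (Suc (Suc k)) = a"
    by (auto simp: braid_move_def)
  let ?u = "prefix_word y k"
  have pre: "prefix_word y (Suc k) = ?u @ [a]" "prefix_word y (Suc (Suc k)) = (?u @ [a]) @ [b]"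
    using y3 by simp_all
  note st = step_in_crossings[OF y, of _ k] step_in_crossings[OF y, of _ "Suc (Suc k)"]
  from ab(3) show ?thesis
  proof
    assume b: "b = (a + 1) mod n"
    note br = word_prod_braid[OF n3 refl[of "int a mod int n"], folded b]
    have "(word_prod n ?u (int a), word_prod n ?u (int a + 1)) \<in> crossings y"
      using st(1)[of "int a"] y3 by simp
    moreover have "(word_prod n ?u (int a + 1), word_prod n ?u (int a + 2)) \<in> crossings y"
      using st(2)[of "int a"] y3 unfolding pre br by simp
    ultimately show ?thesis by blast
  next
    assume a: "a = (b + 1) mod n"
    note br = word_prod_braid[OF n3 refl[of "int b mod int n"], folded a]
    have *: "(int b + 1) mod int n = int a mod int n"
      using braid_gens(7)[OF n3 refl[of "int b mod int n"]] by (simp only: a)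
    have "(word_prod n ?u (int b + 1), word_prod n ?u (int b + 2)) \<in> crossings y"
      using st(1)[of "int b + 1"] * y3 by (simp add: add.assoc)
    moreover have "word_prod n ((?u @ [a]) @ [b]) (int b + 1) = word_prod n ?u (int b)"
      "word_prod n ((?u @ [a]) @ [b]) (int b + 1 + 1) = word_prod n ?u (int b + 1)"
      unfolding add.assoc one_add_one br by simp_all
    then have "(word_prod n ?u (int b), word_prod n ?u (int b + 1)) \<in> crossings y"
      using st(2)[of "int b + 1"] * y3 unfolding pre by simp
    ultimately show ?thesis by blast
  qed
qed

lemma limit_weak_minimal_iff:
  assumes x: "infinite_reduced_word n x"
  shows "limit_weak_minimal n (braid_class n x) \<longleftrightarrow>
    (\<forall>y. infinite_reduced_word n y \<longrightarrow> crossings y \<subseteq> crossings x \<longrightarrow> crossings y = crossings x)"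
proof -
  have cls: "limit_classes n = braid_class n ` {y. infinite_reduced_word n y}"
    by (auto simp: limit_classes_def quotient_def braid_class_def)
  have le: "limit_weak_le n (braid_class n y) (braid_class n x) \<longleftrightarrow> crossings y \<subseteq> crossings x"
    if "infinite_reduced_word n y" for y
    using that x Inv_subset_iff by (auto simp: limit_weak_le_def braid_class_eq)
  have eq: "braid_class n y = braid_class n x \<longleftrightarrow> crossings y = crossings x"
    if "infinite_reduced_word n y" for y
    using that x by (auto simp: braid_class_eq)
  show ?thesis unfolding limit_weak_minimal_def cls using x le eq by auto
qed

end

context affine_rank
begin

section \<open>The three characterisations\<close>

lemma split_of_coxeter_class:
  assumes x: "infinite_reduced_word n x" and u: "coxeter_word n c u"
    and cls: "braid_class n x = braid_class n (repeat_word u)"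
  shows "\<exists>R. crossings x = split_pairs R"
proof -
  interpret coxeter_letters n u by unfold_locales (use u in \<open>auto simp: coxeter_word_def\<close>)
  have "x \<in> braid_class n x" using x by (simp add: braid_class_eq)
  then have "crossings x = crossings (repeat_word u)"
    unfolding cls by (simp add: braid_class_eq[OF infinite_reduced_repeat_word])
  then show ?thesis using crossings_repeat_word by blast
qed

lemma coxeter_class_of_split:
  assumes x: "infinite_reduced_word n x"
    and R: "shift_closed R" "R \<noteq> {}" "R \<noteq> UNIV" "crossings x = split_pairs R"
  shows "\<exists>c u. coxeter_element n c \<and> coxeter_word n c u \<and> braid_class n x = braid_class n (repeat_word u)"
proof -
  obtain u where "coxeter_letters n u" and rm: "coxeter_letters.right_movers n u = R"
    using coxeter_word_exists[OF R(1-3)] by blast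
  then interpret coxeter_letters n u by simp
  \<comment> \<open>\<open>u\<close> is the prefix of length \<open>n\<close> of an infinite reduced
    word.\<close>
  have "reduced_word n (word_prod n u) u"
    using infinite_reduced_repeat_word prefix_repeat_word unfolding infinite_reduced_word_def by metis
  then have cw: "coxeter_word n (word_prod n u) u"
    using distinct letters by (simp add: coxeter_word_def)
  moreover have "coxeter_element n (word_prod n u)"
    using cw word_prod_in_group[of u] letters by (auto simp: coxeter_element_def is_word_def)
  moreover have "braid_class n x = braid_class n (repeat_word u)"
    using crossings_repeat_word rm R(4) by (simp add: braid_class_eq x infinite_reduced_repeat_word)
  ultimately show ?thesis by blast
qed

text \<open>A braid move would yield a chain whose middle particle is both inside and outside
  \<open>R\<close>.\<close>

lemma fully_commutative_of_split:
  assumes x: "infinite_reduced_word n x" and R: "crossings x = split_pairs R"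
  shows "fully_commutative n (braid_class n x)"
  unfolding fully_commutative_def
proof clarify
  fix y z assume "y \<in> braid_class n x" "braid_move n y z"
  then obtain a b c where "(a, b) \<in> crossings x" "(b, c) \<in> crossings x"
    using braid_move_crossings[of y z] by (auto simp: braid_class_eq[OF x])
  then show False by (auto simp: R split_pairs_def)
qed

lemma minimal_of_split:
  assumes x: "infinite_reduced_word n x" and R: "crossings x = split_pairs R"
  shows "limit_weak_minimal n (braid_class n x)"
  unfolding limit_weak_minimal_iff[OF x] R
  using infinite_biconvex.eq_split_pairs[OF infinite_biconvex_crossings] by blast

lemma coxeter_class_of_fully_commutative:
  assumes x: "infinite_reduced_word n x" and fc: "fully_commutative n (braid_class n x)"
  shows "\<exists>c u. coxeter_element n c \<and> coxeter_word n c u \<and> braid_class n x = braid_class n (repeat_word u)"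
proof -
  interpret infinite_biconvex n "crossings x" by (rule infinite_biconvex_crossings[OF x])
  obtain R where R: "shift_closed R" "R \<noteq> {}" "R \<noteq> UNIV" "split_pairs R \<subseteq> crossings x"
    by (rule split_pairs_exists)
  then have "crossings x = split_pairs R"
    using eq_split_pairs_of_avoiding fully_commutative_avoids[OF x fc] by blast
  then show ?thesis using coxeter_class_of_split[OF x R(1-3)] by blast
qed

text \<open>Minimality compares only with crossing sets of words, so \<open>split_pairs R\<close> is
  first realised by an infinite power of a Coxeter word.\<close>

lemma coxeter_class_of_minimal:
  assumes x: "infinite_reduced_word n x" and min: "limit_weak_minimal n (braid_class n x)"
  shows "\<exists>c u. coxeter_element n c \<and> coxeter_word n c u \<and> braid_class n x = braid_class n (repeat_word u)"
proof -
  interpret infinite_biconvex n "crossings x" by (rule infinite_biconvex_crossings[OF x])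
  obtain R where R: "shift_closed R" "R \<noteq> {}" "R \<noteq> UNIV" "split_pairs R \<subseteq> crossings x"
    by (rule split_pairs_exists)
  obtain u where "coxeter_letters n u" and rm: "coxeter_letters.right_movers n u = R"
    using coxeter_word_exists[OF R(1-3)] by blast
  then interpret U: coxeter_letters n u by simp
  have "crossings (repeat_word u) \<subseteq> crossings x"
    using U.crossings_repeat_word rm R(4) by simp
  then have "crossings x = split_pairs R"
    using min U.infinite_reduced_repeat_word U.crossings_repeat_word rm
    unfolding limit_weak_minimal_iff[OF x] by metis
  then show ?thesis using coxeter_class_of_split[OF x R(1-3)] by blast
qed

end

theorem theorem4p25:
  fixes n :: nat and x :: "nat \<Rightarrow> nat"
  assumes "n \<ge> 2"
    and "infinite_reduced_word n x"
  shows "((\<exists>c u. coxeter_element n c \<and> coxeter_word n c u \<and>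
              braid_class n x = braid_class n (repeat_word u))
            \<longleftrightarrow> fully_commutative n (braid_class n x)) \<and>
         (fully_commutative n (braid_class n x)
            \<longleftrightarrow> limit_weak_minimal n (braid_class n x))"
proof -
  interpret affine_rank n by unfold_locales (rule assms(1))
  note x = assms(2)
  \<comment> \<open>A Coxeter class has a split crossing set, which gives (2) and (3); each of these
    leads back to (1).\<close>
  show ?thesis
    using split_of_coxeter_class[OF x] fully_commutative_of_split[OF x] minimal_of_split[OF x]
      coxeter_class_of_fully_commutative[OF x] coxeter_class_of_minimal[OF x] by metis
qed

end
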